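(* Let $a$, $b$, and $n$ be positive integers. The polytope $\mathfrak X_n(a,b)$ is magic positive if and only if $(n,a,b)\ne(2,1,1)$. In the exceptional case, $\mathfrak X_2(1,1)=PF_2$ and $\mathrm{ehr}_{PF_2}(t)=\frac{(t+1)(t+2)}{2}=(t+1)^2-\frac12\,t(t+1)$.
   Context: For $\mathbf b=(b_1,\dots,b_n)\in\mathbb Z_{>0}^n$, a $\mathbf b$-parking function is a list $(\beta_1,\dots,\beta_n)$ of positive integers whose nondecreasing rearrangement $\beta_1'\le\cdots\le\beta_n'$ satisfies $\beta_i'\le b_1+\cdots+b_i$ for all $i$. The polytope $\mathfrak X_n(\mathbf b)\subset\mathbb R^n$ is the convex hull of all $\mathbf b$-parking functions of length $n$, and for positive integers $a,b$, $\mathfrak X_n(a,b):=\mathfrak X_n(a,b,\dots,b)$ (parameter vector of length $n$ with first entry $a$ and all other entries $b$; for $n=1$ it is $\mathfrak X_1(a)$). $PF_n$ is the convex hull in $\mathbb R^n$ of all classical parking functions of length $n$, i.e. lists of $n$ positive integers whose nondecreasing rearrangement satisfies $\alpha_i'\le i$. For a lattice polytope $P\subset\mathbb R^n$, $\mathrm{ehr}_P(t)$ is the polynomial in $t$ that equals $\#(tP\cap\mathbb Z^n)$ at every positive integer $t$. A lattice polytope $P$ of dimension $d$ is magic positive if $\mathrm{ehr}_P(t)=\sum_{i=0}^d\mu_i\,t^i(t+1)^{d-i}$ with $\mu_i\ge0$ for all $i$. *)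

theory Defs
  imports "HOL-Analysis.Analysis" "HOL-Computational_Algebra.Polynomial" "HOL-Library.Multiset"
begin

definition integer_points :: "(real ^ 'n) set" where
  "integer_points = {x. \<forall>i. x $ i \<in> \<int>}"

definition lattice_polytope :: "(real ^ 'n) set \<Rightarrow> bool" where
  "lattice_polytope P \<longleftrightarrow>
     (\<exists>V. finite V \<and> V \<noteq> {} \<and> V \<subseteq> integer_points \<and> P = convex hull V)"

definition is_ehrhart_poly :: "(real ^ 'n) set \<Rightarrow> real poly \<Rightarrow> bool" where
  "is_ehrhart_poly P p \<longleftrightarrow>
     (\<forall>t::nat. t > 0 \<longrightarrow>
        poly p (real t) = real (card ((\<lambda>x. real t *\<^sub>R x) ` P \<inter> integer_points)))"

text \<open>
  Uniqueness is \<open>is_ehrhart_poly_unique\<close> below; existence for lattice polytopes is Ehrhart's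
  theorem. For other sets the value is meaningless.
\<close>
definition ehr :: "(real ^ 'n) set \<Rightarrow> real poly" where
  "ehr P = (THE p. is_ehrhart_poly P p)"

lemma is_ehrhart_poly_unique:
  assumes "is_ehrhart_poly P p" and "is_ehrhart_poly P q"
  shows "p = q"
proof (rule ccontr)
  assume "p \<noteq> q"
  then have "finite {x. poly (p - q) x = 0}"
    by (intro poly_roots_finite) simp
  moreover have "real ` {0<..} \<subseteq> {x. poly (p - q) x = 0}"
    using assms by (auto simp: is_ehrhart_poly_def)
  ultimately have "finite (real ` {0::nat<..})"
    by (rule rev_finite_subset)
  then have "finite {0::nat<..}"
    by (rule finite_imageD) (simp add: inj_on_def)
  then show False
    by (simp add: infinite_Ioi)
qed

lemma ehr_eqI: "is_ehrhart_poly P p \<Longrightarrow> ehr P = p"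
  unfolding ehr_def using is_ehrhart_poly_unique by blast

text \<open>
  A lattice polytope is nonempty here, so \<open>aff_dim P \<ge> 0\<close> and \<open>nat (aff_dim P)\<close> is its dimension.
\<close>
definition magic_positive :: "(real ^ 'n) set \<Rightarrow> bool" where
  "magic_positive P \<longleftrightarrow>
     lattice_polytope P \<and>
     (let d = nat (aff_dim P) in
        \<exists>\<mu> :: nat \<Rightarrow> real. (\<forall>i\<le>d. \<mu> i \<ge> 0) \<and>
          (\<forall>t::real. poly (ehr P) t = (\<Sum>i\<le>d. \<mu> i * t ^ i * (t + 1) ^ (d - i))))"

text \<open>
  A list of length \<open>n\<close> is a vector over an index type of cardinality \<open>n\<close>. No order on the index
  type is needed, since parking functions depend only on the nondecreasing rearrangement, which is
  an ordinary list. Its entry number \<open>i\<close>, counted from 1, is \<open>rearrangement \<beta> ! (i - 1)\<close>.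
\<close>
definition rearrangement :: "nat ^ 'n \<Rightarrow> nat list" where
  "rearrangement \<beta> = sorted_list_of_multiset (image_mset (\<lambda>i. \<beta> $ i) (mset_set UNIV))"

definition b_parking_function :: "nat list \<Rightarrow> nat ^ 'n \<Rightarrow> bool" where
  "b_parking_function bs \<beta> \<longleftrightarrow>
     length bs = CARD('n) \<and>
     (\<forall>i. \<beta> $ i > 0) \<and>
     (\<forall>i\<in>{1..CARD('n)}. rearrangement \<beta> ! (i - 1) \<le> sum_list (take i bs))"

definition classical_parking_function :: "nat ^ 'n \<Rightarrow> bool" where
  "classical_parking_function \<alpha> \<longleftrightarrow>
     (\<forall>i. \<alpha> $ i > 0) \<and> (\<forall>i\<in>{1..CARD('n)}. rearrangement \<alpha> ! (i - 1) \<le> i)"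

definition real_vec :: "nat ^ 'n \<Rightarrow> real ^ 'n" where
  "real_vec \<beta> = (\<chi> i. real (\<beta> $ i))"

definition parking_polytope :: "nat list \<Rightarrow> (real ^ 'n) set" where
  "parking_polytope bs = convex hull (real_vec ` {\<beta>. b_parking_function bs \<beta>})"

definition parking_polytope_ab :: "nat \<Rightarrow> nat \<Rightarrow> (real ^ 'n) set" where
  "parking_polytope_ab a b = parking_polytope (a # replicate (CARD('n) - 1) b)"

definition PF :: "(real ^ 'n) set" where
  "PF = convex hull (real_vec ` {\<alpha>. classical_parking_function \<alpha>})"

end

theory Submission
  imports Defs
begin

text \<open>
  Put \<open>B = t b\<close> and \<open>A = t (a - 1)\<close>. Subtracting each coordinate from the largest value it takes
  in the \<open>t\<close>-th dilate turns the lattice points of the dilate into integer vectors \<open>y\<close> with entries in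
  \<open>{0..B (n - 1) + A}\<close> satisfying Landau's condition \<open>y(R) \<ge> B (|R| choose 2)\<close> for all index sets \<open>R\<close>.
  The function \<open>y(R) - B (|R| choose 2)\<close> is submodular, so it has a smallest and a largest minimizer;
  cutting \<open>y\<close> there yields convolution identities between the number of Landau vectors, of strict
  Landau vectors, and of tight ones (generalized score sequences). With \<open>T = X exp T\<close> the tree
  function, they determine the exponential generating function of the Landau vectors as
  \<open>(1 - T)^(-1/2) exp (- 3 T / 2 + T^2 / 4 + (A / B) T + (1 + 1 / B) \<tau>)\<close> at \<open>B X\<close>, where
  \<open>\<tau> = T - T^2 / 4\<close>. Expanding in powers of \<open>1 + 1 / B\<close> gives the coefficients in the basis
  \<open>B^(n - j) (B + 1)^j\<close>. Up to the first two terms, the power series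
  \<open>(1 - T)^(-1/2) exp (- 3 T / 2 + T^2 / 4)\<close> counts strict Landau vectors and hence has nonnegative
  coefficients; together with the monotonicity of the coefficients of \<open>\<tau>\<close> this gives magic
  positivity for \<open>n \<ge> 3\<close>. The cases \<open>n \<le> 2\<close> are explicit.
\<close>

unbundle no vec_syntax
unbundle fps_syntax

section \<open>The tree function\<close>

text \<open>Three unknown series are linked by three relations. Cutting a weak Landau vector at the
  largest minimizer gives weak = tight * strict. Cutting an arbitrary vector of the box {0..B (n -
  1)} at the smallest one gives strict * weak = exp ((1 / B - 1) T) / (1 - T). Comparing the
  excesses 0 and B gives a differential equation for the tight series alone. Eliminating the strict
  series leaves the square of the weak one, hence the exponent -1/2.

  Powers of B + 1 suit dilation: b t + 1 = (b - 1) t + (t + 1) is a nonnegative combination of t and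
  t + 1, and A / B = (a - 1) / b does not depend on t. The obstacle is a sign: the prefactor has
  coefficient -1 at X, which is fatal for n = 2, a = b = 1. From degree 2 on it is the strict series
  for B = 1 at excess -1, so the removal of maximal entries has to start at A = -1; the remaining 1
  - X is absorbed by powers of \<open>tau\<close> in degrees n \<ge> 3.\<close>

lemma fps_compose_mult_nth:
  fixes F G M :: "real fps"
  assumes "G $ 0 = 0"
  shows "((F oo G) * M) $ n = (\<Sum>k\<le>n. F $ k * (G ^ k * M) $ n)"
proof -
  have *: "(F oo G) $ i = (\<Sum>k\<le>n. F $ k * (G ^ k) $ i)" if "i \<le> n" for i
  proof -
    have "(F oo G) $ i = (\<Sum>k\<in>{0..i}. F $ k * (G ^ k) $ i)"
      by (simp add: fps_compose_nth)
    also have "\<dots> = (\<Sum>k\<le>n. F $ k * (G ^ k) $ i)"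
      using that startsby_zero_power_prefix[OF assms]
      by (intro sum.mono_neutral_left) auto
    finally show ?thesis .
  qed
  have "((F oo G) * M) $ n = (\<Sum>i=0..n. \<Sum>k\<le>n. F $ k * (G ^ k) $ i * M $ (n - i))"
    by (simp add: fps_mult_nth * sum_distrib_right)
  also have "\<dots> = (\<Sum>k\<le>n. \<Sum>i=0..n. F $ k * (G ^ k) $ i * M $ (n - i))"
    by (rule sum.swap)
  also have "\<dots> = (\<Sum>k\<le>n. F $ k * (G ^ k * M) $ n)"
    by (simp add: fps_mult_nth sum_distrib_left mult.assoc)
  finally show ?thesis .
qed

text \<open>The equation determines each coefficient from the lower ones. Exponential identities are
  verified with it by comparing logarithmic derivatives, so that no logarithm of a series has to be
  formed.\<close>

lemma fps_linear_ode_unique: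
  fixes F G D :: "real fps"
  assumes "fps_deriv F = D * F" "fps_deriv G = D * G" "F $ 0 = G $ 0"
  shows "F = G"
proof (rule fps_ext)
  fix n show "F $ n = G $ n"
  proof (induction n rule: less_induct)
    case (less n)
    show ?case
    proof (cases n)
      case 0 then show ?thesis using assms by simp
    next
      case (Suc m)
      have "real (Suc m) * F $ Suc m = (D * F) $ m"
        using arg_cong[OF assms(1), of "\<lambda>F. F $ m"] by simp
      also have "\<dots> = (D * G) $ m"
        using less Suc by (simp add: fps_mult_nth)
      also have "\<dots> = real (Suc m) * G $ Suc m"
        using arg_cong[OF assms(2), of "\<lambda>F. F $ m"] by simp
      finally show ?thesis using Suc by simp
    qed
  qed
qed

definition fexp :: "real fps \<Rightarrow> real fps" where
  "fexp F = fps_exp 1 oo F"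

lemma fexp_nth_0 [simp]: "fexp F $ 0 = 1"
  by (simp add: fexp_def)

lemma fps_deriv_fexp: "F $ 0 = 0 \<Longrightarrow> fps_deriv (fexp F) = fps_deriv F * fexp F"
  unfolding fexp_def by (subst fps_compose_deriv) (auto simp: mult.commute)

lemma fexp_0 [simp]: "fexp 0 = 1"
  by (simp add: fexp_def)

lemma fexp_add:
  assumes "F $ 0 = 0" "G $ 0 = 0"
  shows "fexp (F + G) = fexp F * fexp G"
  by (rule fps_linear_ode_unique[where D = "fps_deriv F + fps_deriv G"])
     (use assms in \<open>simp_all add: fps_deriv_fexp algebra_simps\<close>)

lemma fexp_mult_nth:
  assumes "F $ 0 = 0"
  shows "(fexp (fps_const c * F) * M) $ n = (\<Sum>k\<le>n. c ^ k / fact k * (F ^ k * M) $ n)"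
  unfolding fexp_def using assms
  by (subst fps_compose_mult_nth)
     (auto intro!: sum.cong simp: power_mult_distrib fps_const_power mult.assoc)

definition tree :: "real fps" where
  "tree = fps_inv (fps_X * fps_exp (-1))"

definition texp :: "real \<Rightarrow> real fps" where
  "texp c = fexp (fps_const c * tree)"

lemma tree_nth_0 [simp]: "tree $ 0 = 0"
  by (simp add: tree_def fps_inv_def)

lemma texp_nth_0 [simp]: "texp c $ 0 = 1"
  by (simp add: texp_def)

lemma texp_0 [simp]: "texp 0 = 1"
  by (simp add: texp_def)

lemma texp_add: "texp (a + b) = texp a * texp b"
  unfolding texp_def
  by (subst fexp_add[symmetric]) (simp_all add: algebra_simps flip: fps_const_add)

lemma texp_mult_of_nat: "texp (of_nat k) = texp 1 ^ k"
  by (induction k) (simp_all add: texp_add)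

lemma tree_eq: "tree = fps_X * texp 1"
proof -
  have "(fps_X * fps_exp (-1)) oo tree = (fps_X :: real fps)"
    unfolding tree_def by (rule fps_inv_right) simp_all
  then have *: "tree * (fps_exp (-1) oo tree) = fps_X"
    by (simp add: fps_compose_mult_distrib)
  have "(fps_exp (-1) oo tree) * texp 1 = (fps_exp (-1) * fps_exp 1) oo tree"
    by (simp add: texp_def fexp_def fps_compose_mult_distrib)
  also have "\<dots> = 1"
    by (simp flip: fps_exp_add_mult)
  finally have "tree = tree * (fps_exp (-1) oo tree) * texp 1"
    by (simp add: mult.assoc)
  then show ?thesis using * by simp
qed

lemma tree_power: "tree ^ k = fps_X ^ k * texp (of_nat k)"
  by (subst tree_eq) (simp add: power_mult_distrib texp_mult_of_nat)

text \<open>Expanding exp (s T) and using T^k = X^k exp (k T), multiplication by exp (s T) becomes a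
  recursion whose kth term lowers the degree by k and raises the parameter by k. Abel's binomial
  expansion and the removal of maximal entries (with s = 1 / B) both have this shape.\<close>

lemma texp_step:
  fixes a s :: real
  assumes "\<And>k. k \<le> n \<Longrightarrow> c k = (texp (a + real k) * G) $ (n - k)"
  shows "(\<Sum>k\<le>n. s ^ k / fact k * c k) = (texp (a + s) * G) $ n"
proof -
  have "(texp (a + s) * G) $ n = (texp s * (texp a * G)) $ n"
    by (simp add: texp_add mult_ac)
  also have "\<dots> = (\<Sum>k\<le>n. s ^ k / fact k * (tree ^ k * (texp a * G)) $ n)"
    unfolding texp_def[of s] by (rule fexp_mult_nth) simp
  also have "\<dots> = (\<Sum>k\<le>n. s ^ k / fact k * c k)"
  proof (rule sum.cong)
    fix k assume "k \<in> {..n}"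
    have "tree ^ k * (texp a * G) = fps_X ^ k * (texp (a + real k) * G)"
      by (simp add: tree_power texp_add mult_ac)
    then have "(tree ^ k * (texp a * G)) $ n = (texp (a + real k) * G) $ (n - k)"
      using \<open>k \<in> {..n}\<close> by (simp only: fps_X_power_mult_nth atMost_iff) simp
    with \<open>k \<in> {..n}\<close> show "s ^ k / fact k * (tree ^ k * (texp a * G)) $ n = s ^ k / fact k * c k"
      by (simp add: assms)
  qed simp
  finally show ?thesis by simp
qed

section \<open>Abel's series exp (a T) / (1 - T) and the coefficients of T\<close>

definition abel :: "real \<Rightarrow> real fps" where
  "abel a = Abs_fps (\<lambda>n. (a + real n) ^ n / fact n)"

text \<open>In the binomial expansion of (a + n)^n the kth term contains n^(n - k) = (k + (n -
  k))^(n - k), a coefficient of \<open>abel (real k)\<close> in degree n - k. For k > 0 the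
  induction applies to it; for k = 0 the claim is trivial because \<open>texp 0 = 1\<close>.\<close>

lemma abel_conv: "abel a = texp a * abel 0"
proof (rule fps_ext)
  fix n show "abel a $ n = (texp a * abel 0) $ n"
  proof (induction n arbitrary: a rule: less_induct)
    case (less n)
    have *: "abel (real k) $ (n - k) = (texp (0 + real k) * abel 0) $ (n - k)" if "k \<le> n" for k
      using that less[of "n - k" "real k"] by (cases "k = 0") auto
    have "abel a $ n = (\<Sum>k\<le>n. real (n choose k) * a ^ k * real n ^ (n - k)) / fact n"
      by (simp add: abel_def binomial_ring)
    also have "\<dots> = (\<Sum>k\<le>n. a ^ k / fact k * abel (real k) $ (n - k))"
      unfolding sum_divide_distrib
      by (intro sum.cong) (auto simp: abel_def binomial_fact of_nat_diff)
    also have "\<dots> = (texp (0 + a) * abel 0) $ n"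
      by (rule texp_step) (use * in simp)
    finally show ?case by simp
  qed
qed

lemma abel_mult: "abel a * (1 - tree) = texp a"
proof -
  \<comment> \<open>For n > 0, n^n / n! = (1 + (n - 1))^(n - 1) / (n - 1)!. With X exp T = T this
    becomes a geometric equation for \<open>abel 0\<close>.\<close>
  have "abel 0 = 1 + fps_X * abel 1"
  proof (rule fps_ext)
    fix n show "abel 0 $ n = (1 + fps_X * abel 1) $ n"
      by (cases n) (auto simp: abel_def divide_simps)
  qed
  also have "\<dots> = 1 + tree * abel 0"
    by (subst abel_conv, subst tree_eq) (simp add: mult_ac)
  finally have "abel 0 * (1 - tree) = 1"
    by (simp add: algebra_simps)
  then show ?thesis
    by (subst abel_conv) (simp add: mult.assoc)
qed

lemma one_minus_tree_nonzero: "1 - tree \<noteq> 0"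
  using abel_mult[of 0] by auto

lemma fps_deriv_texp: "fps_deriv (texp c) = fps_const c * fps_deriv tree * texp c"
  by (simp add: texp_def fps_deriv_fexp)

lemma fps_deriv_tree_mult: "fps_deriv tree * (1 - tree) = texp 1"
proof -
  have "fps_deriv tree = texp 1 + fps_X * texp 1 * fps_deriv tree"
    by (subst tree_eq) (simp add: fps_deriv_texp mult_ac)
  then show ?thesis
    unfolding tree_eq[symmetric] by (simp add: algebra_simps)
qed

lemma fps_deriv_tree: "fps_deriv tree = abel 1"
  using fps_deriv_tree_mult abel_mult[of 1] one_minus_tree_nonzero
  by (metis mult_right_cancel)

lemma tree_nth: "n > 0 \<Longrightarrow> tree $ n = real n ^ (n - 1) / fact n"
  using arg_cong[OF fps_deriv_tree, of "\<lambda>F. F $ (n - 1)"]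
  by (cases n) (auto simp: abel_def divide_simps mult_ac)

text \<open>The mean of T and T - T^2 / 2, the series of rooted and of unrooted labelled trees. The
  tight series brings the second into the exponent, the Abel series the first, and the square root
  halves the sum.\<close>

definition tau :: "real fps" where
  "tau = tree - fps_const (1/4) * tree ^ 2"

lemma tau_nth_0 [simp]: "tau $ 0 = 0"
  by (simp add: tau_def)

lemma tau_nth:
  assumes "n > 0"
  shows "tau $ n = (real n + 1) * real n ^ (n - 1) / (2 * real n * fact n)"
proof -
  \<comment> \<open>T - T^2 / 2 has derivative exp T = T / X, so its coefficients are those of T
    divided by n.\<close>
  have "fps_deriv (tree - fps_const (1/2) * tree ^ 2) = fps_deriv tree * (1 - tree)"
    by (simp add: power2_eq_square algebra_simps)
  also have "\<dots> = texp 1" by (rule fps_deriv_tree_mult)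
  finally have "real n * (tree - fps_const (1/2) * tree ^ 2) $ n = texp 1 $ (n - 1)"
    using assms by (metis Suc_pred' fps_deriv_nth Suc_eq_plus1 mult.commute)
  also have "\<dots> = tree $ n"
    using assms by (subst tree_eq) (cases n, auto)
  finally have "(tree - fps_const (1/2) * tree ^ 2) $ n = tree $ n / real n"
    using assms by (simp add: field_simps)
  then have "tau $ n = (tree $ n + tree $ n / real n) / 2"
    by (simp add: tau_def)
  then show ?thesis using assms by (simp add: tree_nth field_simps)
qed

section \<open>Submodular functions and decompositions of integer vectors\<close>

definition tri :: "nat \<Rightarrow> int" where
  "tri k = int (k choose 2)"

lemma tri_0 [simp]: "tri 0 = 0" and tri_1 [simp]: "tri (Suc 0) = 0"
  by (simp_all add: tri_def)

lemma tri_Suc: "tri (Suc k) = tri k + int k"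
  by (simp add: tri_def numeral_2_eq_2)

lemma tri_add: "tri (s + r) = tri s + tri r + int s * int r"
  by (induction r) (simp_all add: tri_Suc algebra_simps)

lemma two_tri: "2 * tri k = int k * (int k - 1)"
  by (induction k) (simp_all add: tri_Suc algebra_simps)

lemma tri_nonneg: "tri k \<ge> 0"
  by (simp add: tri_def)

lemma sum_subset_split:
  fixes y :: "'a \<Rightarrow> int"
  assumes "finite E" "R \<subseteq> E"
  shows "sum y R = sum y (R \<inter> K) + sum y (R - K)" "card R = card (R \<inter> K) + card (R - K)"
proof -
  have R: "finite R" using assms(2,1) by (rule finite_subset)
  then show "sum y R = sum y (R \<inter> K) + sum y (R - K)" by (rule sum.Int_Diff)
  show "card R = card (R \<inter> K) + card (R - K)"
    unfolding card_eq_sum using R by (rule sum.Int_Diff)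
qed

text \<open>A common form for all families counted here: membership depends only on cardinalities
  and sums, so relabelling, translation and reflection need a single argument.
  \<open>extensional\<close> gives each vector on E one representative, so that cardinalities are
  meaningful.\<close>

definition subset_sums :: "(nat \<Rightarrow> int \<Rightarrow> int \<Rightarrow> bool) \<Rightarrow> 'a set \<Rightarrow> ('a \<Rightarrow> int) set" where
  "subset_sums \<psi> E = {y \<in> extensional E. \<forall>R\<subseteq>E. \<psi> (card R) (sum y R) (sum y E)}"

text \<open>An entrywise map y -> \<sigma> y + c changes a sum s over R into \<sigma> s + c |R|. The
  sign \<sigma> = 1 normalizes shifts, \<sigma> = -1 gives the reflection of
  \<open>co_landau\<close>.\<close>

lemma card_subset_sums_affine:
  fixes E :: "'a set" and E' :: "'b set" and \<sigma> c :: int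
  assumes E: "finite E" "finite E'" "card E = card E'" and \<sigma>: "\<sigma> * \<sigma> = 1"
    and \<psi>: "\<And>k s S. k \<le> card E \<Longrightarrow> \<psi> k s S \<longleftrightarrow> \<psi>' k (\<sigma> * s + c * int k) (\<sigma> * S + c * int (card E))"
  shows "card (subset_sums \<psi> E) = card (subset_sums \<psi>' E')"
proof -
  obtain e where e: "bij_betw e E E'"
    using finite_same_card_bij[OF E] by blast
  define g where "g = inv_into E e"
  have g: "bij_betw g E' E" unfolding g_def using e by (rule bij_betw_inv_into)
  have ge: "\<And>x. x \<in> E \<Longrightarrow> g (e x) = x" and eg: "\<And>x. x \<in> E' \<Longrightarrow> e (g x) = x"
    unfolding g_def using e
    by (simp_all add: bij_betw_inv_into_left bij_betw_inv_into_right)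
  have eE: "\<And>x. x \<in> E \<Longrightarrow> e x \<in> E'" and gE: "\<And>x. x \<in> E' \<Longrightarrow> g x \<in> E"
    using e g by (auto simp: bij_betw_def)
  define \<Phi> where "\<Phi> y = (\<lambda>x\<in>E'. \<sigma> * y (g x) + c)" for y :: "'a \<Rightarrow> int"
  define \<Psi> where "\<Psi> z = (\<lambda>x\<in>E. \<sigma> * (z (e x) - c))" for z :: "'b \<Rightarrow> int"
  have sum_\<Phi>: "sum (\<Phi> y) (e ` R) = \<sigma> * sum y R + c * int (card R)" if "R \<subseteq> E" for y R
  proof -
    have "inj_on e R" using e that by (auto simp: bij_betw_def intro: inj_on_subset)
    then have "sum (\<Phi> y) (e ` R) = (\<Sum>x\<in>R. \<Phi> y (e x))" by (simp add: sum.reindex)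
    also have "\<dots> = (\<Sum>x\<in>R. \<sigma> * y x + c)"
      using that by (intro sum.cong) (auto simp: \<Phi>_def eE ge)
    finally show ?thesis by (simp add: sum.distrib sum_distrib_left)
  qed
  have imE: "e ` E = E'" using e by (simp add: bij_betw_def)
  have key: "\<Phi> y \<in> subset_sums \<psi>' E' \<longleftrightarrow> y \<in> subset_sums \<psi> E" if "y \<in> extensional E" for y
  proof -
    have "(\<forall>R\<subseteq>E'. \<psi>' (card R) (sum (\<Phi> y) R) (sum (\<Phi> y) E'))
      \<longleftrightarrow> (\<forall>R\<subseteq>E. \<psi>' (card (e ` R)) (sum (\<Phi> y) (e ` R)) (sum (\<Phi> y) (e ` E)))"
      unfolding imE by (simp flip: imE add: all_subset_image)
    also have "\<dots> \<longleftrightarrow> (\<forall>R\<subseteq>E. \<psi> (card R) (sum y R) (sum y E))"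
    proof (intro all_cong imp_cong refl)
      fix R assume R: "R \<subseteq> E"
      then have "card (e ` R) = card R"
        using e by (auto simp: bij_betw_def intro: card_image inj_on_subset)
      moreover have "card R \<le> card E" using R E(1) by (rule card_mono[rotated])
      ultimately show "\<psi>' (card (e ` R)) (sum (\<Phi> y) (e ` R)) (sum (\<Phi> y) (e ` E))
          \<longleftrightarrow> \<psi> (card R) (sum y R) (sum y E)"
        using R by (simp add: sum_\<Phi> \<psi>)
    qed
    finally show ?thesis using that by (auto simp: subset_sums_def \<Phi>_def)
  qed
  have inv1: "\<Psi> (\<Phi> y) = y" if "y \<in> extensional E" for y
    using that \<sigma> by (auto simp: \<Phi>_def \<Psi>_def ge eE extensional_def fun_eq_iff simp flip: mult.assoc)
  have inv2: "\<Phi> (\<Psi> z) = z" if "z \<in> extensional E'" for z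
    using that \<sigma> by (auto simp: \<Phi>_def \<Psi>_def eg gE extensional_def fun_eq_iff simp flip: mult.assoc)
  have "bij_betw \<Phi> (subset_sums \<psi> E) (subset_sums \<psi>' E')"
  proof (rule bij_betw_byWitness[where f' = \<Psi>])
    show "\<forall>y\<in>subset_sums \<psi> E. \<Psi> (\<Phi> y) = y"
      using inv1 by (auto simp: subset_sums_def)
    show "\<forall>z\<in>subset_sums \<psi>' E'. \<Phi> (\<Psi> z) = z"
      using inv2 by (auto simp: subset_sums_def)
    show "\<Phi> ` subset_sums \<psi> E \<subseteq> subset_sums \<psi>' E'"
      using key by (auto simp: subset_sums_def)
    show "\<Psi> ` subset_sums \<psi>' E' \<subseteq> subset_sums \<psi> E"
    proof
      fix y assume "y \<in> \<Psi> ` subset_sums \<psi>' E'"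
      then obtain z where z: "z \<in> subset_sums \<psi>' E'" "y = \<Psi> z" by auto
      have "z \<in> extensional E'" using z by (simp add: subset_sums_def)
      moreover have "y \<in> extensional E" using z by (simp add: \<Psi>_def)
      ultimately show "y \<in> subset_sums \<psi> E"
        using key[of y] inv2[of z] z by simp
    qed
  qed
  then show ?thesis by (rule bij_betw_same_card)
qed

lemma sum_Pow_card:
  fixes g :: "nat \<Rightarrow> nat"
  assumes "finite E"
  shows "(\<Sum>K\<in>Pow E. g (card K)) = (\<Sum>k\<le>card E. (card E choose k) * g k)"
proof -
  have "(\<Sum>K\<in>Pow E. g (card K)) = (\<Sum>k\<le>card E. \<Sum>K\<in>{K \<in> Pow E. card K = k}. g (card K))"
    using assms by (intro sum.group[symmetric]) (auto simp: card_mono)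
  also have "\<dots> = (\<Sum>k\<le>card E. (card E choose k) * g k)"
    using assms by (intro sum.cong) (auto simp: n_subsets)
  finally show ?thesis .
qed

text \<open>Each vector selects exactly one subset K, and the selection splits into independent
  conditions on the restrictions to K and E - K. Since both counts depend on |K| only, this yields a
  binomial convolution, that is, a product of exponential generating functions.\<close>

lemma card_glue:
  fixes C :: "('a \<Rightarrow> int) set"
  assumes "finite E" "finite C"
    and C: "C \<subseteq> extensional E"
    and A: "\<And>K. K \<subseteq> E \<Longrightarrow> A K \<subseteq> extensional K"
    and D: "\<And>K. K \<subseteq> E \<Longrightarrow> D K \<subseteq> extensional (E - K)"
    and ex1: "\<And>y. y \<in> C \<Longrightarrow> \<exists>!K. K \<subseteq> E \<and> \<rho> y K"
    and iff: "\<And>y K. K \<subseteq> E \<Longrightarrow> y \<in> extensional E \<Longrightarrow>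
               y \<in> C \<and> \<rho> y K \<longleftrightarrow> restrict y K \<in> A K \<and> restrict y (E - K) \<in> D K"
    and cards: "\<And>K. K \<subseteq> E \<Longrightarrow> card (A K) = \<alpha> (card K)"
      "\<And>K. K \<subseteq> E \<Longrightarrow> card (D K) = \<delta> (card K)"
  shows "card C = (\<Sum>k\<le>card E. (card E choose k) * (\<alpha> k * \<delta> k))"
proof -
  define CK where "CK K = {y \<in> C. \<rho> y K}" for K
  have "C = (\<Union>K\<in>Pow E. CK K)"
    using ex1 by (auto simp: CK_def dest!: ex1_implies_ex)
  also have "card \<dots> = (\<Sum>K\<in>Pow E. card (CK K))"
    using assms(1,2) ex1 by (intro card_UN_disjoint) (auto simp: CK_def)
  also have "\<dots> = (\<Sum>K\<in>Pow E. \<alpha> (card K) * \<delta> (card K))"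
  proof (rule sum.cong)
    fix K assume "K \<in> Pow E"
    then have K: "K \<subseteq> E" by simp
    define \<Psi> where "\<Psi> p = (\<lambda>x. if x \<in> K then fst p x else snd p x)" for p :: "('a \<Rightarrow> int) \<times> ('a \<Rightarrow> int)"
    have recover: "restrict (\<Psi> p) K = fst p" "restrict (\<Psi> p) (E - K) = snd p" "\<Psi> p \<in> extensional E"
      if "p \<in> A K \<times> D K" for p
    proof -
      have "fst p \<in> extensional K" "snd p \<in> extensional (E - K)"
        using that A[OF K] D[OF K] by auto
      then show "restrict (\<Psi> p) K = fst p" "restrict (\<Psi> p) (E - K) = snd p" "\<Psi> p \<in> extensional E"
        using K by (auto simp: \<Psi>_def extensional_def fun_eq_iff)
    qed
    have "bij_betw (\<lambda>y. (restrict y K, restrict y (E - K))) (CK K) (A K \<times> D K)"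
    proof (rule bij_betw_byWitness[where f' = \<Psi>])
      show "\<forall>y\<in>CK K. \<Psi> (restrict y K, restrict y (E - K)) = y"
        using C by (auto simp: CK_def \<Psi>_def fun_eq_iff extensional_def subset_iff)
      show "\<forall>p\<in>A K \<times> D K. (restrict (\<Psi> p) K, restrict (\<Psi> p) (E - K)) = p"
        using recover by auto
      show "(\<lambda>y. (restrict y K, restrict y (E - K))) ` CK K \<subseteq> A K \<times> D K"
        using C iff[OF K] by (auto simp: CK_def)
      show "\<Psi> ` (A K \<times> D K) \<subseteq> CK K"
      proof
        fix y assume "y \<in> \<Psi> ` (A K \<times> D K)"
        then obtain p where p: "p \<in> A K \<times> D K" "y = \<Psi> p" by auto
        then show "y \<in> CK K" using iff[OF K, of y] recover[OF p(1)] by (auto simp: CK_def)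
      qed
    qed
    then have "card (CK K) = card (A K \<times> D K)" by (rule bij_betw_same_card)
    then show "card (CK K) = \<alpha> (card K) * \<delta> (card K)"
      using K by (simp add: card_cartesian_product cards)
  qed simp
  also have "\<dots> = (\<Sum>k\<le>card E. (card E choose k) * (\<alpha> k * \<delta> k))"
    using assms(1) by (rule sum_Pow_card)
  finally show ?thesis .
qed

section \<open>Largest and smallest minimizers of submodular functions\<close>

definition submodular_on :: "'a set \<Rightarrow> ('a set \<Rightarrow> int) \<Rightarrow> bool" where
  "submodular_on E h \<longleftrightarrow> (\<forall>S T. S \<subseteq> E \<longrightarrow> T \<subseteq> E \<longrightarrow> h (S \<union> T) + h (S \<inter> T) \<le> h S + h T)"

text \<open>K is compared only with its subsets and supersets, because such comparisons split into a
  condition on K and one on E - K, as gluing requires. For submodular h they already force K to be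
  the largest minimizer among all subsets of E.\<close>

definition maximal_minimizer :: "'a set \<Rightarrow> ('a set \<Rightarrow> int) \<Rightarrow> 'a set \<Rightarrow> bool" where
  "maximal_minimizer E h K \<longleftrightarrow>
     (\<forall>R\<subseteq>K. h K \<le> h R) \<and> (\<forall>R\<subseteq>E - K. R \<noteq> {} \<longrightarrow> h K < h (K \<union> R))"

definition minimal_minimizer :: "'a set \<Rightarrow> ('a set \<Rightarrow> int) \<Rightarrow> 'a set \<Rightarrow> bool" where
  "minimal_minimizer E h K \<longleftrightarrow>
     (\<forall>R\<subseteq>K. R \<noteq> {} \<longrightarrow> h K < h (K - R)) \<and> (\<forall>R\<subseteq>E - K. h K \<le> h (K \<union> R))"

lemma ex1_maximal_minimizer:
  assumes "finite E" and h: "submodular_on E h"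
  shows "\<exists>!K. K \<subseteq> E \<and> maximal_minimizer E h K"
proof -
  \<comment> \<open>By submodularity h T \<ge> h (K \<union> T) + h (K \<inter> T) - h K. Both
    values on the right are at least h K, the first strictly so unless T \<subseteq> K.\<close>
  have glob: "h K \<le> h T \<and> (h T = h K \<longrightarrow> T \<subseteq> K)"
    if K: "K \<subseteq> E" "maximal_minimizer E h K" and T: "T \<subseteq> E" for K T
  proof -
    have "h (K \<union> T) + h (K \<inter> T) \<le> h K + h T"
      using h K(1) T by (simp add: submodular_on_def)
    moreover have "h K \<le> h (K \<inter> T)" using K by (simp add: maximal_minimizer_def)
    moreover have "h K < h (K \<union> T)" if "\<not> T \<subseteq> K"
    proof -
      have "T - K \<subseteq> E - K" "T - K \<noteq> {}" using T that by auto
      then have "h K < h (K \<union> (T - K))" using K(2) unfolding maximal_minimizer_def by metis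
      then show ?thesis by simp
    qed
    moreover have "K \<union> T = K" if "T \<subseteq> K" using that by blast
    ultimately show ?thesis by (cases "T \<subseteq> K") auto
  qed
  define v where "v = Min (h ` Pow E)"
  have vmin: "v \<le> h T" if "T \<subseteq> E" for T
    unfolding v_def using assms(1) that by (intro Min_le) auto
  have "v \<in> h ` Pow E" unfolding v_def using assms(1) by (intro Min_in) auto
  then obtain K0 where K0: "K0 \<subseteq> E" "h K0 = v" by auto
  have "\<exists>K. (K \<subseteq> E \<and> h K = v) \<and> (\<forall>L. L \<subseteq> E \<and> h L = v \<longrightarrow> card L \<le> card K)"
    by (rule ex_has_greatest_nat[where b = "Suc (card E)" and k = K0])
       (use K0 assms(1) in \<open>auto simp: card_mono less_Suc_eq_le\<close>)
  then obtain K where K: "K \<subseteq> E" "h K = v" "\<And>L. L \<subseteq> E \<Longrightarrow> h L = v \<Longrightarrow> card L \<le> card K"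
    by blast
  have maxK: "maximal_minimizer E h K"
    unfolding maximal_minimizer_def
  proof (intro conjI allI impI)
    fix R assume "R \<subseteq> K" then show "h K \<le> h R" using K vmin[of R] by auto
  next
    fix R assume R: "R \<subseteq> E - K" "R \<noteq> {}"
    then have KR: "K \<union> R \<subseteq> E" "K \<subset> K \<union> R" using K(1) by auto
    then have "card K < card (K \<union> R)"
      using assms(1) by (intro psubset_card_mono) (auto intro: finite_subset)
    then have "h (K \<union> R) \<noteq> v" using K(3)[OF KR(1)] by auto
    then show "h K < h (K \<union> R)" using vmin[OF KR(1)] K(2) by simp
  qed
  show ?thesis
  proof (rule ex1I[of _ K])
    show "K \<subseteq> E \<and> maximal_minimizer E h K" using K(1) maxK by simp
    fix L assume L: "L \<subseteq> E \<and> maximal_minimizer E h L"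
    then have "h L \<le> h K \<and> (h K = h L \<longrightarrow> K \<subseteq> L)" using glob[of L K] K(1) by simp
    moreover have "h K \<le> h L \<and> (h L = h K \<longrightarrow> L \<subseteq> K)" using glob[OF K(1) maxK] L by simp
    ultimately show "L = K" by (metis order_antisym)
  qed
qed

text \<open>Complementation preserves submodularity and reverses inclusion, which reduces smallest
  minimizers to largest ones.\<close>

lemma maximal_minimizer_complement:
  assumes "L \<subseteq> E"
  shows "maximal_minimizer E (\<lambda>S. h (E - S)) (E - L) \<longleftrightarrow> minimal_minimizer E h L"
proof -
  have LL: "E - (E - L) = L" using assms by blast
  have "(\<forall>R\<subseteq>E - L. h L \<le> h (E - R)) \<longleftrightarrow> (\<forall>R\<subseteq>E - L. h L \<le> h (L \<union> R))"
  proof (intro iffI allI impI)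
    fix R assume a: "\<forall>R\<subseteq>E - L. h L \<le> h (E - R)" and R: "R \<subseteq> E - L"
    have "E - (E - L - R) = L \<union> R" using assms R by blast
    then show "h L \<le> h (L \<union> R)" using a[rule_format, of "E - L - R"] by auto
  next
    fix R assume a: "\<forall>R\<subseteq>E - L. h L \<le> h (L \<union> R)" and R: "R \<subseteq> E - L"
    have "L \<union> (E - L - R) = E - R" using assms R by blast
    then show "h L \<le> h (E - R)" using a[rule_format, of "E - L - R"] by auto
  qed
  moreover have "E - ((E - L) \<union> R) = L - R" for R using assms by blast
  ultimately show ?thesis
    unfolding maximal_minimizer_def minimal_minimizer_def LL by simp metis
qed

lemma ex1_minimal_minimizer:
  assumes "finite E" and h: "submodular_on E h"
  shows "\<exists>!K. K \<subseteq> E \<and> minimal_minimizer E h K"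
proof -
  have "submodular_on E (\<lambda>S. h (E - S))"
    unfolding submodular_on_def
  proof (intro allI impI)
    fix S T assume "S \<subseteq> E" "T \<subseteq> E"
    have "h ((E - S) \<union> (E - T)) + h ((E - S) \<inter> (E - T)) \<le> h (E - S) + h (E - T)"
      using h by (simp add: submodular_on_def)
    moreover have "(E - S) \<union> (E - T) = E - S \<inter> T" "(E - S) \<inter> (E - T) = E - (S \<union> T)" by auto
    ultimately show "h (E - (S \<union> T)) + h (E - S \<inter> T) \<le> h (E - S) + h (E - T)" by simp
  qed
  then have ex1: "\<exists>!M. M \<subseteq> E \<and> maximal_minimizer E (\<lambda>S. h (E - S)) M"
    by (rule ex1_maximal_minimizer[OF assms(1)])
  then obtain M where M: "M \<subseteq> E" "maximal_minimizer E (\<lambda>S. h (E - S)) M"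
    by (elim ex1E conjE)
  have uniq: "L = M" if "L \<subseteq> E" "maximal_minimizer E (\<lambda>S. h (E - S)) L" for L
    using the1_equality[OF ex1 conjI[OF that]] the1_equality[OF ex1 conjI[OF M]] by simp
  have MM: "E - (E - M) = M" using M(1) by blast
  show ?thesis
  proof (rule ex1I[of _ "E - M"])
    show "E - M \<subseteq> E \<and> minimal_minimizer E h (E - M)"
      using maximal_minimizer_complement[of "E - M" E h] M(2) MM by simp
  next
    fix L assume L: "L \<subseteq> E \<and> minimal_minimizer E h L"
    then have "E - L = M" using maximal_minimizer_complement[of L E h] by (intro uniq) auto
    then show "L = E - M" using L by blast
  qed
qed

section \<open>Landau vectors\<close>

text \<open>Integrality lets \<open>d = 1\<close> express the strict inequality; the empty set must
  then be excluded. The linear term \<open>c\<close> accounts for the cross term left by a block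
  that has been cut off.\<close>

definition landau :: "int \<Rightarrow> int \<Rightarrow> int \<Rightarrow> int \<Rightarrow> 'a set \<Rightarrow> ('a \<Rightarrow> int) set" where
  "landau B d c m E = {y \<in> extensional E. (\<forall>i\<in>E. y i \<le> m) \<and>
     (\<forall>R\<subseteq>E. R \<noteq> {} \<longrightarrow> d + B * tri (card R) + c * int (card R) \<le> sum y R)}"

text \<open>
  The upper bound is parametrized by its excess \<open>A\<close> over \<open>B (n - 1)\<close>, because this makes the
  recursion in \<open>A\<close> and the decompositions uniform in \<open>n\<close>.
\<close>

definition landau_count :: "int \<Rightarrow> int \<Rightarrow> int \<Rightarrow> nat \<Rightarrow> nat" where
  "landau_count B d A n = card (landau B d 0 (B * (int n - 1) + A) {..<n})"

lemma landau_subset_sums: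
  assumes "finite E"
  shows "landau B d c m E = subset_sums (\<lambda>k s S. k \<noteq> 0 \<longrightarrow>
           (k = 1 \<longrightarrow> s \<le> m) \<and> d + B * tri k + c * int k \<le> s) E" (is "_ = ?S")
proof -
  have *: "card R = 0 \<longleftrightarrow> R = {}" if "R \<subseteq> E" for R
    using that assms finite_subset by fastforce
  have "(\<forall>i\<in>E. y i \<le> m) \<longleftrightarrow> (\<forall>R\<subseteq>E. card R = 1 \<longrightarrow> sum y R \<le> m)" for y :: "'a \<Rightarrow> int"
  proof (intro iffI allI impI ballI)
    fix R assume "\<forall>i\<in>E. y i \<le> m" "R \<subseteq> E" "card R = 1"
    then show "sum y R \<le> m" by (auto simp: card_1_singleton_iff)
  next
    fix i assume "\<forall>R\<subseteq>E. card R = 1 \<longrightarrow> sum y R \<le> m" "i \<in> E"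
    from this(1)[rule_format, of "{i}"] this(2) show "y i \<le> m" by simp
  qed
  moreover have "(\<forall>R\<subseteq>E. R \<noteq> {} \<longrightarrow> d + B * tri (card R) + c * int (card R) \<le> sum y R) \<longleftrightarrow>
     (\<forall>R\<subseteq>E. card R \<noteq> 0 \<longrightarrow> d + B * tri (card R) + c * int (card R) \<le> sum y R)" for y :: "'a \<Rightarrow> int"
    using * by simp
  ultimately show ?thesis
    unfolding landau_def subset_sums_def
    by (intro Collect_cong) (simp del: One_nat_def, fastforce)
qed

lemma card_landau:
  assumes "finite E"
  shows "card (landau B d c m E) = landau_count B d (m - c - B * (int (card E) - 1)) (card E)"
proof -
  have "card (landau B d c m E) = card (landau B d 0 (m - c) {..<card E})"
    unfolding landau_subset_sums[OF assms] landau_subset_sums[OF finite_lessThan]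
    by (rule card_subset_sums_affine[where \<sigma> = 1 and c = "- c"])
       (use assms in \<open>auto simp: algebra_simps\<close>)
  then show ?thesis by (simp add: landau_count_def)
qed

lemma finite_landau:
  assumes "finite E"
  shows "finite (landau B d c m E)"
proof (rule finite_subset)
  show "landau B d c m E \<subseteq> E \<rightarrow>\<^sub>E {d + c..m}"
  proof
    fix y assume y: "y \<in> landau B d c m E"
    have "d + c \<le> y i" if "i \<in> E" for i
    proof -
      have "\<forall>R\<subseteq>E. R \<noteq> {} \<longrightarrow> d + B * tri (card R) + c * int (card R) \<le> sum y R"
        using y by (simp add: landau_def)
      from this[rule_format, of "{i}"] that show ?thesis by simp
    qed
    then show "y \<in> E \<rightarrow>\<^sub>E {d + c..m}" using y by (auto simp: landau_def PiE_def)
  qed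
  show "finite (E \<rightarrow>\<^sub>E {d + c..m})" using assms by (intro finite_PiE) auto
qed

lemma landau_count_0 [simp]: "landau_count B d A 0 = 1"
proof -
  have "landau B d 0 m ({} :: nat set) = {\<lambda>_. undefined}" for m
    by (auto simp: landau_def)
  then show ?thesis unfolding landau_count_def by simp
qed

lemma restrict_landau_iff:
  "restrict y K \<in> landau B d c m K \<longleftrightarrow> (\<forall>i\<in>K. y i \<le> m) \<and>
     (\<forall>R\<subseteq>K. R \<noteq> {} \<longrightarrow> d + B * tri (card R) + c * int (card R) \<le> sum y R)"
proof -
  have "sum (restrict y K) R = sum y R" if "R \<subseteq> K" for R
    using that by (intro sum.cong) auto
  then show ?thesis by (simp add: landau_def)
qed

text \<open>Adding k entries of value M requires B (tri k + k r) \<le> k M, and M \<ge> B (n - 1)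
  even leaves a surplus of B tri k. For k \<ge> 2 this surplus is at least 1 and pays for
  \<open>d\<close>; for k = 1 the assumption M \<ge> d does.\<close>

lemma landau_top_bound:
  assumes B: "B \<ge> 1" and d: "d = 0 \<or> d = 1" and m: "M \<ge> B * (int n - 1)" "M \<ge> d" "M \<ge> 0"
    and k: "k > 0" "k + r \<le> n"
  shows "B * tri (k + r) \<le> B * tri r + int k * M" "d + B * tri k \<le> int k * M"
proof -
  have "0 \<le> B * tri k" using B by (simp add: tri_nonneg)
  have "int k * (B * (int n - 1)) \<le> int k * M" using m by (intro mult_left_mono) auto
  moreover have "int k * (B * (int k + int r - 1)) \<le> int k * (B * (int n - 1))"
    using k B by (intro mult_left_mono) auto
  ultimately have 1: "int k * (B * (int k + int r - 1)) \<le> int k * M" by linarith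
  have 2: "int k * (B * (int k + int r - 1)) = 2 * (B * tri k) + B * (int k * int r)"
    unfolding right_diff_distrib distrib_left
    using arg_cong[OF two_tri[of k], of "\<lambda>x. B * x"] by (simp add: algebra_simps)
  show "B * tri (k + r) \<le> B * tri r + int k * M"
    using 1 2 \<open>0 \<le> B * tri k\<close> by (simp add: tri_add algebra_simps)
  show "d + B * tri k \<le> int k * M"
  proof (cases "k = 1")
    case True then show ?thesis using m by simp
  next
    case False
    then obtain j where j: "k = Suc (Suc j)" using k(1) by (cases k; cases "k - 1") auto
    have "1 \<le> tri k" using j by (simp add: tri_Suc tri_nonneg)
    then have "1 \<le> B * tri k" using B by (metis mult_mono' mult_1 zero_le_one)
    moreover have "0 \<le> B * (int k * int r)" using B by simp
    ultimately show ?thesis using 1 2 d by linarith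
  qed
qed

text \<open>Removing the entries equal to the upper bound.\<close>

lemma landau_count_step:
  assumes B: "B \<ge> 1" and d: "d = 0 \<or> d = 1"
    and A: "A \<ge> -1" "n > 0 \<Longrightarrow> B * (int n - 1) + A + 1 \<ge> d"
  shows "landau_count B d (A + 1) n =
    (\<Sum>k\<le>n. (n choose k) * landau_count B d (A + B * int k) (n - k))"
proof (cases "n = 0")
  case True then show ?thesis by simp
next
  case False
  define m where "m = B * (int n - 1) + A"
  define E where "E = {..<n}"
  define C where "C = landau B d 0 (m + 1) E"
  have E: "finite E" "card E = n" by (simp_all add: E_def)
  have "landau_count B d (A + 1) n = card C"
    by (simp add: landau_count_def C_def m_def E_def algebra_simps)
  also have "card C = (\<Sum>k\<le>card E. (card E choose k) * (1 * landau_count B d (A + B * int k) (card E - k)))"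
  proof (rule card_glue[where A = "\<lambda>K. K \<rightarrow>\<^sub>E {m + 1}" and D = "\<lambda>K. landau B d 0 m (E - K)"
        and \<rho> = "\<lambda>y K. {i \<in> E. y i = m + 1} = K"])
    show "finite C" unfolding C_def using E by (intro finite_landau)
    show "C \<subseteq> extensional E" by (auto simp: C_def landau_def)
    show "(K \<rightarrow>\<^sub>E {m + 1}) \<subseteq> extensional K" for K by (auto simp: PiE_def)
    show "landau B d 0 m (E - K) \<subseteq> extensional (E - K)" for K by (auto simp: landau_def)
    show "\<exists>!K. K \<subseteq> E \<and> {i \<in> E. y i = m + 1} = K" for y by auto
    fix K assume K: "K \<subseteq> E"
    show "card (K \<rightarrow>\<^sub>E {m + 1}) = 1" using K E by (subst card_PiE) (auto intro: finite_subset)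
    have "card (E - K) = card E - card K" "card K \<le> card E"
      using K E by (auto intro: card_Diff_subset card_mono finite_subset)
    moreover have "m - B * (int (card E - card K) - 1) = A + B * int (card K)"
      using \<open>card K \<le> card E\<close> by (simp add: m_def E of_nat_diff algebra_simps)
    ultimately show "card (landau B d 0 m (E - K)) = landau_count B d (A + B * int (card K)) (card E - card K)"
      using E by (subst card_landau) auto
    fix y :: "nat \<Rightarrow> int" assume y: "y \<in> extensional E"
    show "(y \<in> C \<and> {i \<in> E. y i = m + 1} = K) \<longleftrightarrow>
      (restrict y K \<in> K \<rightarrow>\<^sub>E {m + 1} \<and> restrict y (E - K) \<in> landau B d 0 m (E - K))"
    proof (intro iffI conjI)
      assume L: "y \<in> C \<and> {i \<in> E. y i = m + 1} = K"
      then have "y i = m + 1" if "i \<in> K" for i using that by blast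
      then show "restrict y K \<in> K \<rightarrow>\<^sub>E {m + 1}" by auto
      have "y i \<le> m" if "i \<in> E - K" for i
      proof -
        have "y i \<le> m + 1" using L that by (simp add: C_def landau_def)
        moreover have "y i \<noteq> m + 1" using L that by blast
        ultimately show ?thesis by simp
      qed
      moreover have "R \<subseteq> E" if "R \<subseteq> E - K" for R using that by blast
      ultimately show "restrict y (E - K) \<in> landau B d 0 m (E - K)"
        using L unfolding restrict_landau_iff unfolding C_def landau_def by simp
    next
      assume R: "restrict y K \<in> K \<rightarrow>\<^sub>E {m + 1} \<and> restrict y (E - K) \<in> landau B d 0 m (E - K)"
      have yK: "y i = m + 1" if "i \<in> K" for i
        using PiE_mem[OF conjunct1[OF R] that] that by simp
      have ym: "\<And>i. i \<in> E - K \<Longrightarrow> y i \<le> m"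
        and out: "\<And>S. S \<subseteq> E - K \<Longrightarrow> S \<noteq> {} \<Longrightarrow> d + B * tri (card S) \<le> sum y S"
        using R by (simp_all add: restrict_landau_iff)
      show "{i \<in> E. y i = m + 1} = K" using yK ym K by force
      show "y \<in> C" unfolding C_def landau_def
      proof (intro CollectI conjI ballI allI impI y)
        fix i assume "i \<in> E" then show "y i \<le> m + 1" using yK[of i] ym[of i] by force
      next
        fix S assume S: "S \<subseteq> E" "S \<noteq> {}"
        have split: "sum y S = sum y (S \<inter> K) + sum y (S - K)"
            "card S = card (S \<inter> K) + card (S - K)"
          by (rule sum_subset_split[OF E(1) S(1)])+
        have "sum y (S \<inter> K) = (\<Sum>i\<in>S \<inter> K. m + 1)" using yK by (intro sum.cong) auto
        then have sK: "sum y (S \<inter> K) = int (card (S \<inter> K)) * (m + 1)" by simp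
        have le: "card (S \<inter> K) + card (S - K) \<le> n"
          using card_mono[OF E(1) S(1)] E(2) split(2) by linarith
        have fin: "finite S" using S(1) E(1) by (rule finite_subset)
        have m: "m + 1 \<ge> B * (int n - 1)" "m + 1 \<ge> d" "m + 1 \<ge> 0"
          using A False d by (auto simp: m_def algebra_simps)
        \<comment> \<open>The slack \<open>d\<close> is gained once: from the part outside K if that
          is nonempty, and otherwise from the entries at the bound.\<close>
        consider "S \<inter> K = {}" | "S \<inter> K \<noteq> {}" "S - K \<noteq> {}" | "S \<inter> K \<noteq> {}" "S - K = {}" by blast
        then show "d + B * tri (card S) + 0 * int (card S) \<le> sum y S"
        proof cases
          case 1
          then have "S \<subseteq> E - K" using S by blast
          then show ?thesis using out S by simp
        next
          case 2
          have pos: "card (S \<inter> K) > 0" using 2 fin by (simp add: card_gt_0_iff)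
          have "d + B * tri (card (S - K)) \<le> sum y (S - K)" using 2 S by (intro out) auto
          then show ?thesis
            using landau_top_bound(1)[OF B d m pos le] split sK by simp
        next
          case 3
          have pos: "card (S \<inter> K) > 0" using 3 fin by (simp add: card_gt_0_iff)
          show ?thesis using landau_top_bound(2)[OF B d m pos le] split sK 3(2) by simp
        qed
      qed
    qed
  qed (rule E)
  finally show ?thesis by (simp add: E)
qed

text \<open>Landau vectors on K for which K minimizes its own height. For c = 0, comparison with the
  empty set forces the total B tri |K|; for c = 0 and B = 1 these are the score vectors of
  tournaments.\<close>

definition tight :: "int \<Rightarrow> int \<Rightarrow> 'a set \<Rightarrow> ('a \<Rightarrow> int) set" where
  "tight B c K = {y \<in> extensional K. \<forall>R\<subseteq>K. B * tri (card R) \<le> sum y R \<and>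
     sum y K - B * tri (card K) - c * B * int (card K) \<le> sum y R - B * tri (card R) - c * B * int (card R)}"

definition tight_count :: "int \<Rightarrow> int \<Rightarrow> nat \<Rightarrow> nat" where
  "tight_count B c n = card (tight B c {..<n})"

lemma card_tight:
  assumes "finite K"
  shows "card (tight B c K) = tight_count B c (card K)"
proof -
  have *: "tight B c E = subset_sums (\<lambda>k s S. B * tri k \<le> s \<and>
     S - B * tri (card K) - c * B * int (card K) \<le> s - B * tri k - c * B * int k) E"
    if "card E = card K" for E :: "'b set"
    unfolding tight_def subset_sums_def that ..
  have **: "tight B c K = subset_sums (\<lambda>k s S. B * tri k \<le> s \<and>
     S - B * tri (card K) - c * B * int (card K) \<le> s - B * tri k - c * B * int k) K"
    unfolding tight_def subset_sums_def ..
  show ?thesis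
    unfolding ** tight_count_def *[of "{..<card K}", simplified]
    by (rule card_subset_sums_affine[where \<sigma> = 1 and c = 0]) (use assms in simp_all)
qed

section \<open>The height of a set and the cut at its largest minimizer\<close>

definition height :: "int \<Rightarrow> int \<Rightarrow> ('a \<Rightarrow> int) \<Rightarrow> 'a set \<Rightarrow> int" where
  "height B c y S = sum y S - B * tri (card S) - c * B * int (card S)"

text \<open>The cross term |S| |R| of \<open>tri\<close> makes the gain from adding R a Landau
  expression in R with linear shift B (|S| + c).\<close>

lemma height_Un:
  assumes "finite S" "finite R" "S \<inter> R = {}"
  shows "height B c y (S \<union> R) = height B c y S + sum y R - B * tri (card R)
           - B * (int (card S) + c) * int (card R)"
  using assms by (simp add: height_def sum.union_disjoint card_Un_disjoint tri_add algebra_simps)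

text \<open>\<open>tri\<close> is convex in the cardinality; the submodularity defect is exactly B
  |S - T| |T - S|.\<close>

lemma submodular_height:
  assumes "finite E" "B \<ge> 0"
  shows "submodular_on E (height B c y)"
  unfolding submodular_on_def
proof (intro allI impI)
  fix S T assume ST: "S \<subseteq> E" "T \<subseteq> E"
  define I U V where "I = S \<inter> T" and "U = S - T" and "V = T - S"
  have fin: "finite I" "finite U" "finite V"
    using finite_subset[OF ST(1) assms(1)] finite_subset[OF ST(2) assms(1)]
    by (simp_all add: I_def U_def V_def)
  have eqs: "S = I \<union> U" "T = I \<union> V" "S \<union> T = I \<union> (U \<union> V)" "S \<inter> T = I"
    by (auto simp: I_def U_def V_def)
  have disj: "I \<inter> U = {}" "I \<inter> V = {}" "I \<inter> (U \<union> V) = {}" "U \<inter> V = {}"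
    by (auto simp: I_def U_def V_def)
  have "0 \<le> B * (int (card U) * int (card V))" using assms by simp
  then show "height B c y (S \<union> T) + height B c y (S \<inter> T) \<le> height B c y S + height B c y T"
    unfolding eqs(3,4) unfolding eqs(1,2) using fin disj
    by (simp add: height_Un card_Un_disjoint sum.union_disjoint tri_add algebra_simps)
qed

lemma restrict_tight_iff:
  "restrict y K \<in> tight B c K \<longleftrightarrow>
     (\<forall>R\<subseteq>K. B * tri (card R) \<le> sum y R \<and> height B c y K \<le> height B c y R)"
proof -
  have "sum (restrict y K) R = sum y R" if "R \<subseteq> K" for R
    using that by (intro sum.cong) auto
  then show ?thesis by (simp add: tight_def height_def)
qed

text \<open>At the largest minimizer K of the height, minimality on subsets makes the inner part
  tight, and strict growth on supersets makes the outer part a strict Landau vector with shift B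
  (|K| + c). The height contains c B |R| so that this shift uses up the excess c B of the bound: the
  outer part has excess 0.\<close>

lemma landau_count_maximal_decomposition:
  assumes B: "B \<ge> 1" and c: "c \<ge> 0"
  shows "landau_count B 0 (c * B) n =
    (\<Sum>k\<le>n. (n choose k) * (tight_count B c k * landau_count B 1 0 (n - k)))"
proof -
  define m where "m = B * (int n - 1) + c * B"
  define E where "E = {..<n}"
  define C where "C = landau B 0 0 m E"
  have E: "finite E" "card E = n" by (simp_all add: E_def)
  have C_iff: "y \<in> C \<longleftrightarrow> y \<in> extensional E \<and> (\<forall>i\<in>E. y i \<le> m) \<and>
      (\<forall>R\<subseteq>E. R \<noteq> {} \<longrightarrow> B * tri (card R) \<le> sum y R)" for y
    by (simp add: C_def landau_def)
  have "landau_count B 0 (c * B) n = card C"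
    by (simp add: landau_count_def C_def m_def E_def)
  also have "card C = (\<Sum>k\<le>card E. (card E choose k) * (tight_count B c k * landau_count B 1 0 (card E - k)))"
  proof (rule card_glue[where A = "tight B c"
        and D = "\<lambda>K. landau B 1 (B * (int (card K) + c)) m (E - K)"
        and \<rho> = "\<lambda>y. maximal_minimizer E (height B c y)"])
    show "finite C" unfolding C_def using E by (intro finite_landau)
    show "C \<subseteq> extensional E" using C_iff by blast
    show "tight B c K \<subseteq> extensional K" for K :: "nat set" by (auto simp: tight_def)
    show "landau B 1 (B * (int (card K) + c)) m (E - K) \<subseteq> extensional (E - K)" for K
      by (auto simp: landau_def)
    show "\<exists>!K. K \<subseteq> E \<and> maximal_minimizer E (height B c y) K" for y
      using E B by (intro ex1_maximal_minimizer submodular_height) auto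
    fix K assume K: "K \<subseteq> E"
    have fK: "finite K" using K E(1) by (rule finite_subset)
    have kn: "card K \<le> n" using card_mono[OF E(1) K] E(2) by simp
    show "card (tight B c K) = tight_count B c (card K)" by (rule card_tight[OF fK])
    have cd: "card (E - K) = card E - card K"
      using K fK by (simp add: card_Diff_subset)
    have "m - B * (int (card K) + c) - B * (int (card E - card K) - 1) = 0"
      using kn by (simp add: m_def E of_nat_diff algebra_simps)
    then show "card (landau B 1 (B * (int (card K) + c)) m (E - K)) = landau_count B 1 0 (card E - card K)"
      using E by (subst card_landau) (simp_all add: cd)
    fix y :: "nat \<Rightarrow> int" assume y: "y \<in> extensional E"
    have hU: "height B c y (K \<union> R) = height B c y K + sum y R - B * tri (card R)
           - B * (int (card K) + c) * int (card R)" if "R \<subseteq> E - K" for R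
      using that fK E finite_subset[of R E] by (intro height_Un) auto
    show "(y \<in> C \<and> maximal_minimizer E (height B c y) K) \<longleftrightarrow>
      (restrict y K \<in> tight B c K \<and> restrict y (E - K) \<in> landau B 1 (B * (int (card K) + c)) m (E - K))"
    proof (intro iffI conjI)
      assume L: "y \<in> C \<and> maximal_minimizer E (height B c y) K"
      show "restrict y K \<in> tight B c K"
        unfolding restrict_tight_iff
      proof (intro allI impI conjI)
        fix R assume R: "R \<subseteq> K"
        show "height B c y K \<le> height B c y R" using L R by (simp add: maximal_minimizer_def)
        show "B * tri (card R) \<le> sum y R"
        proof (cases "R = {}")
          case False
          moreover have "R \<subseteq> E" using R K by blast
          ultimately show ?thesis using L by (simp add: C_iff)
        qed simp
      qed
      show "restrict y (E - K) \<in> landau B 1 (B * (int (card K) + c)) m (E - K)"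
        unfolding restrict_landau_iff
      proof (intro conjI ballI allI impI)
        fix i assume "i \<in> E - K" then show "y i \<le> m" using L by (simp add: C_iff)
      next
        fix R assume R: "R \<subseteq> E - K" "R \<noteq> {}"
        then have "height B c y K < height B c y (K \<union> R)"
          using L by (simp add: maximal_minimizer_def)
        then show "1 + B * tri (card R) + B * (int (card K) + c) * int (card R) \<le> sum y R"
          using hU[OF R(1)] by linarith
      qed
    next
      assume "restrict y K \<in> tight B c K \<and> restrict y (E - K) \<in> landau B 1 (B * (int (card K) + c)) m (E - K)"
      then have inner: "\<And>R. R \<subseteq> K \<Longrightarrow> B * tri (card R) \<le> sum y R"
          "\<And>R. R \<subseteq> K \<Longrightarrow> height B c y K \<le> height B c y R"
        and outer: "\<And>i. i \<in> E - K \<Longrightarrow> y i \<le> m"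
          "\<And>R. R \<subseteq> E - K \<Longrightarrow> R \<noteq> {} \<Longrightarrow> 1 + B * tri (card R) + B * (int (card K) + c) * int (card R) \<le> sum y R"
        unfolding restrict_tight_iff restrict_landau_iff by blast+
      show "maximal_minimizer E (height B c y) K"
        unfolding maximal_minimizer_def
      proof (intro conjI allI impI)
        fix R assume "R \<subseteq> K" then show "height B c y K \<le> height B c y R" by (rule inner)
      next
        fix R assume R: "R \<subseteq> E - K" "R \<noteq> {}"
        show "height B c y K < height B c y (K \<union> R)"
          using hU[OF R(1)] outer(2)[OF R] by linarith
      qed
      show "y \<in> C"
        unfolding C_iff
      proof (intro conjI ballI allI impI y)
        fix i assume i: "i \<in> E"
        show "y i \<le> m"
        proof (cases "i \<in> K")
          case True
          \<comment> \<open>Comparing K with K - {i} bounds y i by B (|K| - 1 + c), so tightness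
            implies the upper bound m on K.\<close>
          define R where "R = K - {i}"
          have R: "K = R \<union> {i}" "R \<inter> {i} = {}" "finite R"
            using True fK by (auto simp: R_def)
          then have "card K = card R + 1" by (simp add: card_Un_disjoint)
          have "height B c y K = height B c y R + y i - B * (int (card R) + c)"
            using height_Un[OF R(3) _ R(2), of B c y] R(1) by simp
          moreover have "height B c y K \<le> height B c y R" by (rule inner) (simp add: R_def)
          ultimately have "y i \<le> B * (int (card R) + c)" by linarith
          also have "\<dots> \<le> B * (int n - 1 + c)"
            using \<open>card K = card R + 1\<close> kn B by (intro mult_left_mono) auto
          finally show ?thesis by (simp add: m_def algebra_simps)
        next
          case False then show ?thesis using i outer by blast
        qed
      next
        fix S assume S: "S \<subseteq> E" "S \<noteq> {}"
        define T R where "T = S \<inter> K" and "R = S - K"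
        have split: "sum y S = sum y T + sum y R" "card S = card T + card R"
          unfolding T_def R_def by (rule sum_subset_split[OF E(1) S(1)])+
        show "B * tri (card S) \<le> sum y S"
        proof (cases "R = {}")
          case True
          then have "S \<subseteq> K" by (auto simp: R_def)
          then show ?thesis by (rule inner)
        next
          case False
          have "1 + B * tri (card R) + B * (int (card K) + c) * int (card R) \<le> sum y R"
            using False S by (intro outer) (auto simp: R_def)
          moreover have "B * tri (card T) \<le> sum y T" by (rule inner) (simp add: T_def)
          \<comment> \<open>The outer shift covers the cross term B |T| |R| because |T| \<le> |K|
            and c \<ge> 0.\<close>
          moreover have "B * int (card T) * int (card R) \<le> B * (int (card K) + c) * int (card R)"
          proof -
            have "card T \<le> card K" unfolding T_def using fK by (intro card_mono) auto
            then show ?thesis using B c by (intro mult_right_mono mult_left_mono) auto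
          qed
          ultimately show ?thesis unfolding split by (simp add: tri_add algebra_simps)
        qed
      qed
    qed
  qed (rule E)
  finally show ?thesis by (simp add: E)
qed

text \<open>The last entry of a tight vector is determined by the others.\<close>

lemma tight_count_Suc: "tight_count B 1 n = tight_count B 0 (Suc n)"
proof -
  define E where "E = {..<n}"
  have E: "finite E" "card E = n" "n \<notin> E" "{..<Suc n} = insert n E" by (auto simp: E_def)
  define \<Psi> where "\<Psi> y = y(n := B * tri (Suc n) - sum y E)" for y :: "nat \<Rightarrow> int"
  have sum_insert: "sum y (insert n R) = sum y R + y n" "card (insert n R) = Suc (card R)"
    if "R \<subseteq> E" for y :: "nat \<Rightarrow> int" and R
  proof -
    have "finite R" "n \<notin> R" using that E finite_subset[of R E] by auto
    then show "sum y (insert n R) = sum y R + y n" "card (insert n R) = Suc (card R)" by simp_all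
  qed
  have sum_upd: "sum (y(n := v)) R = sum y R" if "R \<subseteq> E" for y :: "nat \<Rightarrow> int" and v R
    using that E by (intro sum.cong) auto
  have mem0: "y \<in> tight B 0 (insert n E) \<longleftrightarrow> y \<in> extensional (insert n E) \<and>
      (\<forall>R\<subseteq>E. B * tri (card R) \<le> sum y R) \<and> (\<forall>R\<subseteq>E. B * tri (Suc (card R)) \<le> sum y R + y n) \<and>
      sum y E + y n = B * tri (Suc n)" for y
  proof
    assume "y \<in> tight B 0 (insert n E)"
    then have ext: "y \<in> extensional (insert n E)"
      and *: "\<And>R. R \<subseteq> insert n E \<Longrightarrow> B * tri (card R) \<le> sum y R"
      and **: "\<And>R. R \<subseteq> insert n E \<Longrightarrow> sum y (insert n E) - B * tri (card (insert n E)) \<le> sum y R - B * tri (card R)"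
      by (simp_all add: tight_def)
    have "B * tri (card R) \<le> sum y R" if "R \<subseteq> E" for R using that by (intro *) auto
    moreover have "B * tri (Suc (card R)) \<le> sum y R + y n" if "R \<subseteq> E" for R
      using *[of "insert n R"] sum_insert[OF that] that by auto
    moreover have "sum y E + y n = B * tri (Suc n)"
      using *[of "insert n E"] **[of "{}"] sum_insert[OF order_refl] E by simp
    ultimately show "y \<in> extensional (insert n E) \<and>
      (\<forall>R\<subseteq>E. B * tri (card R) \<le> sum y R) \<and> (\<forall>R\<subseteq>E. B * tri (Suc (card R)) \<le> sum y R + y n) \<and>
      sum y E + y n = B * tri (Suc n)" using ext by blast
  next
    assume a: "y \<in> extensional (insert n E) \<and>
      (\<forall>R\<subseteq>E. B * tri (card R) \<le> sum y R) \<and> (\<forall>R\<subseteq>E. B * tri (Suc (card R)) \<le> sum y R + y n) \<and>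
      sum y E + y n = B * tri (Suc n)"
    have low: "B * tri (card R) \<le> sum y R" if R: "R \<subseteq> insert n E" for R
    proof (cases "n \<in> R")
      case True
      then have "R - {n} \<subseteq> E" "R = insert n (R - {n})" using R by auto
      then show ?thesis using a sum_insert[of "R - {n}"] by metis
    next
      case False then show ?thesis using a R by (simp add: subset_insert)
    qed
    have "sum y (insert n E) - B * tri (card (insert n E)) = 0"
      using a sum_insert[OF order_refl] E by simp
    then show "y \<in> tight B 0 (insert n E)" using a low by (simp add: tight_def)
  qed
  \<comment> \<open>As tri n + n = tri (n + 1), the linear term with c = 1 turns minimality of E
    into Landau's condition for R with the last index added.\<close>
  have mem1: "y \<in> tight B 1 E \<longleftrightarrow> y \<in> extensional E \<and> (\<forall>R\<subseteq>E. B * tri (card R) \<le> sum y R) \<and>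
      (\<forall>R\<subseteq>E. B * tri (Suc (card R)) \<le> sum y R + (B * tri (Suc n) - sum y E))" for y
    by (auto simp: tight_def tri_Suc algebra_simps E)
  have "bij_betw (\<lambda>y. restrict y E) (tight B 0 (insert n E)) (tight B 1 E)"
  proof (rule bij_betw_byWitness[where f' = \<Psi>])
    have r: "sum (restrict y E) R = sum y R" if "R \<subseteq> E" for y :: "nat \<Rightarrow> int" and R
      using that by (intro sum.cong) auto
    show "\<forall>y\<in>tight B 0 (insert n E). \<Psi> (restrict y E) = y"
    proof
      fix y assume y: "y \<in> tight B 0 (insert n E)"
      then have "y n = B * tri (Suc n) - sum y E" "y \<in> extensional (insert n E)"
        by (simp_all add: mem0)
      then show "\<Psi> (restrict y E) = y"
        by (auto simp: \<Psi>_def r fun_eq_iff extensional_def)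
    qed
    show "\<forall>y\<in>tight B 1 E. restrict (\<Psi> y) E = y"
      using E by (auto simp: \<Psi>_def tight_def fun_eq_iff extensional_def)
    show "(\<lambda>y. restrict y E) ` tight B 0 (insert n E) \<subseteq> tight B 1 E"
    proof (clarify)
      fix y assume y: "y \<in> tight B 0 (insert n E)"
      then have "y n = B * tri (Suc n) - sum y E" by (simp add: mem0)
      with y show "restrict y E \<in> tight B 1 E" by (simp add: mem0 mem1 r del: restrict_apply)
    qed
    show "\<Psi> ` tight B 1 E \<subseteq> tight B 0 (insert n E)"
    proof (clarify)
      fix y assume y: "y \<in> tight B 1 E"
      have "\<Psi> y \<in> extensional (insert n E)" using y by (auto simp: mem1 \<Psi>_def extensional_def)
      moreover have "\<Psi> y n = B * tri (Suc n) - sum y E" by (simp add: \<Psi>_def)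
      moreover have "sum (\<Psi> y) R = sum y R" if "R \<subseteq> E" for R
        unfolding \<Psi>_def using that by (rule sum_upd)
      ultimately show "\<Psi> y \<in> tight B 0 (insert n E)" using y by (simp add: mem0 mem1)
    qed
  qed
  then show ?thesis unfolding tight_count_def E(4) E_def[symmetric]
    by (rule bij_betw_same_card[symmetric])
qed

lemma tight_count_0 [simp]: "tight_count B 0 0 = 1"
proof -
  have "tight B 0 ({} :: nat set) = {\<lambda>_. undefined}" by (auto simp: tight_def)
  then show ?thesis unfolding tight_count_def by simp
qed

text \<open>
  The restriction of a vector to the smallest minimizer; the reflection \<open>y \<mapsto> B (k - 1) - y\<close> turns it
  into a strict Landau vector.
\<close>

definition co_landau :: "int \<Rightarrow> 'a set \<Rightarrow> ('a \<Rightarrow> int) set" where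
  "co_landau B K = {y \<in> extensional K. (\<forall>i\<in>K. 0 \<le> y i) \<and>
     (\<forall>R\<subseteq>K. R \<noteq> {} \<longrightarrow> sum y R < B * (int (card R) * (int (card K) - 1) - tri (card R)))}"

lemma restrict_co_landau_iff:
  assumes "finite K"
  shows "restrict y K \<in> co_landau B K \<longleftrightarrow> (\<forall>i\<in>K. 0 \<le> y i) \<and>
     (\<forall>R\<subseteq>K. R \<noteq> {} \<longrightarrow> height B 0 y K < height B 0 y (K - R))"
proof -
  have r: "sum (restrict y K) R = sum y R" if "R \<subseteq> K" for R
    using that by (intro sum.cong) auto
  have "height B 0 y K < height B 0 y (K - R) \<longleftrightarrow>
      sum y R < B * (int (card R) * (int (card K) - 1) - tri (card R))" if R: "R \<subseteq> K" for R
  proof -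
    have fin: "finite (K - R)" "finite R" "(K - R) \<inter> R = {}"
      using assms R finite_subset by auto
    have K: "K = (K - R) \<union> R" using R by blast
    have k: "card K = card (K - R) + card R"
      using card_Un_disjoint[OF fin] K by simp
    have "height B 0 y K = height B 0 y (K - R) + sum y R - B * tri (card R)
        - B * int (card (K - R)) * int (card R)"
      using height_Un[OF fin, of B 0 y] K by simp
    \<comment> \<open>The left side is the form that the reflection sends to the strict Landau
      condition.\<close>
    moreover have "B * (int (card R) * (int (card K) - 1) - tri (card R)) =
        B * tri (card R) + B * int (card (K - R)) * int (card R)"
    proof -
      have "int (card R) * (int (card K) - 1) - tri (card R)
          = int (card R) * (int (card R) - 1) - tri (card R) + int (card (K - R)) * int (card R)"
        by (simp add: k algebra_simps)
      also have "\<dots> = tri (card R) + int (card (K - R)) * int (card R)"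
        using two_tri[of "card R"] by linarith
      finally show ?thesis by (simp add: algebra_simps)
    qed
    ultimately show ?thesis by linarith
  qed
  then show ?thesis by (simp add: co_landau_def r restrict_apply' del: restrict_apply cong: ball_cong)
qed

lemma co_landau_subset_sums:
  assumes "finite E"
  shows "co_landau B E = subset_sums (\<lambda>k s S. k \<noteq> 0 \<longrightarrow>
           (k = 1 \<longrightarrow> 0 \<le> s) \<and> s < B * (int k * (int (card E) - 1) - tri k)) E"
proof -
  have *: "card R = 0 \<longleftrightarrow> R = {}" if "R \<subseteq> E" for R
    using that assms finite_subset by fastforce
  have "(\<forall>i\<in>E. 0 \<le> y i) \<longleftrightarrow> (\<forall>R\<subseteq>E. card R = 1 \<longrightarrow> 0 \<le> sum y R)" for y :: "'a \<Rightarrow> int"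
  proof (intro iffI allI impI ballI)
    fix R assume "\<forall>i\<in>E. 0 \<le> y i" "R \<subseteq> E" "card R = 1"
    then show "0 \<le> sum y R" by (auto simp: card_1_singleton_iff)
  next
    fix i assume "\<forall>R\<subseteq>E. card R = 1 \<longrightarrow> 0 \<le> sum y R" "i \<in> E"
    from this(1)[rule_format, of "{i}"] this(2) show "0 \<le> y i" by simp
  qed
  moreover have "(\<forall>R\<subseteq>E. R \<noteq> {} \<longrightarrow> sum y R < B * (int (card R) * (int (card E) - 1) - tri (card R))) \<longleftrightarrow>
     (\<forall>R\<subseteq>E. card R \<noteq> 0 \<longrightarrow> sum y R < B * (int (card R) * (int (card E) - 1) - tri (card R)))" for y :: "'a \<Rightarrow> int"
    using * by simp
  ultimately show ?thesis
    unfolding co_landau_def subset_sums_def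
    by (intro Collect_cong) (simp del: One_nat_def, fastforce)
qed

lemma card_co_landau:
  assumes "finite K"
  shows "card (co_landau B K) = landau_count B 1 0 (card K)"
  unfolding landau_count_def co_landau_subset_sums[OF assms] landau_subset_sums[OF finite_lessThan]
  by (rule card_subset_sums_affine[where \<sigma> = "-1" and c = "B * (int (card K) - 1)"])
     (use assms in \<open>auto simp: algebra_simps\<close>)

text \<open>The left side imposes no Landau condition: every vector of the box {0..B (n - 1)} is cut
  at the smallest minimizer of its height. Inside, the strict inequalities give a reflected strict
  Landau vector; outside, a weak one of excess 0 remains. That the left side is explicit closes the
  system of identities.\<close>

lemma landau_count_minimal_decomposition:
  assumes B: "B \<ge> 1"
  shows "nat (B * (int n - 1) + 1) ^ n =
    (\<Sum>k\<le>n. (n choose k) * (landau_count B 1 0 k * landau_count B 0 0 (n - k)))"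
proof -
  define m where "m = B * (int n - 1)"
  define E where "E = {..<n}"
  define C where "C = E \<rightarrow>\<^sub>E {0..m}"
  have E: "finite E" "card E = n" by (simp_all add: E_def)
  have C_iff: "y \<in> C \<longleftrightarrow> y \<in> extensional E \<and> (\<forall>i\<in>E. 0 \<le> y i \<and> y i \<le> m)" for y
    by (auto simp: C_def PiE_iff)
  have "nat (B * (int n - 1) + 1) ^ n = card C"
    by (simp add: C_def m_def E card_PiE)
  also have "card C = (\<Sum>k\<le>card E. (card E choose k) * (landau_count B 1 0 k * landau_count B 0 0 (card E - k)))"
  proof (rule card_glue[where A = "co_landau B"
        and D = "\<lambda>K. landau B 0 (B * int (card K)) m (E - K)"
        and \<rho> = "\<lambda>y. minimal_minimizer E (height B 0 y)"])
    show "finite C" unfolding C_def using E by (intro finite_PiE) auto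
    show "C \<subseteq> extensional E" using C_iff by blast
    show "co_landau B K \<subseteq> extensional K" for K :: "nat set" by (auto simp: co_landau_def)
    show "landau B 0 (B * int (card K)) m (E - K) \<subseteq> extensional (E - K)" for K
      by (auto simp: landau_def)
    show "\<exists>!K. K \<subseteq> E \<and> minimal_minimizer E (height B 0 y) K" for y
      using E B by (intro ex1_minimal_minimizer submodular_height) auto
    fix K assume K: "K \<subseteq> E"
    have fK: "finite K" using K E(1) by (rule finite_subset)
    have kn: "card K \<le> n" using card_mono[OF E(1) K] E(2) by simp
    show "card (co_landau B K) = landau_count B 1 0 (card K)" by (rule card_co_landau[OF fK])
    have cd: "card (E - K) = card E - card K"
      using K fK by (simp add: card_Diff_subset)
    have "m - B * int (card K) - B * (int (card E - card K) - 1) = 0"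
      using kn by (simp add: m_def E of_nat_diff algebra_simps)
    then show "card (landau B 0 (B * int (card K)) m (E - K)) = landau_count B 0 0 (card E - card K)"
      using E by (subst card_landau) (simp_all add: cd)
    fix y :: "nat \<Rightarrow> int" assume y: "y \<in> extensional E"
    have hU: "height B 0 y (K \<union> R) = height B 0 y K + sum y R - B * tri (card R)
           - B * int (card K) * int (card R)" if "R \<subseteq> E - K" for R
    proof -
      have "height B 0 y (K \<union> R) = height B 0 y K + sum y R - B * tri (card R)
           - B * (int (card K) + 0) * int (card R)"
        using that fK E finite_subset[of R E] by (intro height_Un) auto
      then show ?thesis by simp
    qed
    show "(y \<in> C \<and> minimal_minimizer E (height B 0 y) K) \<longleftrightarrow>
      (restrict y K \<in> co_landau B K \<and> restrict y (E - K) \<in> landau B 0 (B * int (card K)) m (E - K))"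
      unfolding restrict_co_landau_iff[OF fK] restrict_landau_iff
    proof (intro iffI conjI ballI allI impI)
      assume L: "y \<in> C \<and> minimal_minimizer E (height B 0 y) K"
      show "0 \<le> y i" if "i \<in> K" for i using that K L C_iff by blast
      show "y i \<le> m" if "i \<in> E - K" for i using that L C_iff by blast
      show "height B 0 y K < height B 0 y (K - R)" if "R \<subseteq> K" "R \<noteq> {}" for R
        using that L by (simp add: minimal_minimizer_def)
      show "0 + B * tri (card R) + B * int (card K) * int (card R) \<le> sum y R"
        if R: "R \<subseteq> E - K" "R \<noteq> {}" for R
      proof -
        have "height B 0 y K \<le> height B 0 y (K \<union> R)"
          using R L by (simp add: minimal_minimizer_def)
        then show ?thesis using hU[OF R(1)] by linarith
      qed
    next
      assume "((\<forall>i\<in>K. 0 \<le> y i) \<and>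
          (\<forall>R\<subseteq>K. R \<noteq> {} \<longrightarrow> height B 0 y K < height B 0 y (K - R))) \<and>
        (\<forall>i\<in>E - K. y i \<le> m) \<and>
        (\<forall>R\<subseteq>E - K. R \<noteq> {} \<longrightarrow> 0 + B * tri (card R) + B * int (card K) * int (card R) \<le> sum y R)"
      then have inner: "\<And>i. i \<in> K \<Longrightarrow> 0 \<le> y i"
          "\<And>R. R \<subseteq> K \<Longrightarrow> R \<noteq> {} \<Longrightarrow> height B 0 y K < height B 0 y (K - R)"
        and outer: "\<And>i. i \<in> E - K \<Longrightarrow> y i \<le> m"
          "\<And>R. R \<subseteq> E - K \<Longrightarrow> R \<noteq> {} \<Longrightarrow> B * tri (card R) + B * int (card K) * int (card R) \<le> sum y R"
        by simp_all
      show "minimal_minimizer E (height B 0 y) K"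
        unfolding minimal_minimizer_def
      proof (intro conjI allI impI)
        fix R assume "R \<subseteq> K" "R \<noteq> {}"
        then show "height B 0 y K < height B 0 y (K - R)" by (rule inner)
      next
        fix R assume R: "R \<subseteq> E - K"
        show "height B 0 y K \<le> height B 0 y (K \<union> R)"
          using hU[OF R] outer(2)[OF R] by (cases "R = {}") simp_all
      qed
      show "y \<in> C"
        unfolding C_iff
      proof (intro conjI ballI y)
        fix i assume i: "i \<in> E"
        \<comment> \<open>Each box bound not imposed on a piece follows from the cut: strict
          minimality gives y i \<le> B (|K| - 1) on K, and the outer Landau condition gives y i
          \<ge> B |K| off K.\<close>
        have "0 \<le> y i \<and> y i \<le> m"
        proof (cases "i \<in> K")
          case True
          define R where "R = K - {i}"
          have R: "K = R \<union> {i}" "R \<inter> {i} = {}" "finite R"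
            using True fK by (auto simp: R_def)
          then have k: "card K = card R + 1" by (simp add: card_Un_disjoint)
          have "height B 0 y K = height B 0 y R + y i - B * int (card R)"
            using height_Un[OF R(3) _ R(2), of B 0 y] R(1) by simp
          moreover have "height B 0 y K < height B 0 y R"
            using inner(2)[of "{i}"] True by (simp add: R_def)
          ultimately have "y i \<le> B * int (card R)" by linarith
          also have "\<dots> \<le> B * (int n - 1)"
            using k kn B by (intro mult_left_mono) auto
          finally show ?thesis using inner(1)[OF True] by (simp add: m_def)
        next
          case False
          then have "B * int (card K) \<le> y i" using outer(2)[of "{i}"] i by simp
          moreover have "0 \<le> B * int (card K)" using B by simp
          ultimately show ?thesis using outer(1) i False by force
        qed
        then show "0 \<le> y i" "y i \<le> m" by auto
      qed
    qed
  qed (rule E)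
  finally show ?thesis by (simp add: E)
qed

section \<open>Generating functions of Landau vectors\<close>

text \<open>Dividing by B^n makes the shift of the excess by B k in the removal recursion a factor
  exp (k T).\<close>

definition landau_fps :: "int \<Rightarrow> int \<Rightarrow> int \<Rightarrow> real fps" where
  "landau_fps B d A = Abs_fps (\<lambda>n. real (landau_count B d A n) / (fact n * of_int B ^ n))"

definition tight_fps :: "int \<Rightarrow> int \<Rightarrow> real fps" where
  "tight_fps B c = Abs_fps (\<lambda>n. real (tight_count B c n) / (fact n * of_int B ^ n))"

lemma binomial_term:
  fixes B x :: real
  assumes "k \<le> n" "B \<noteq> 0"
  shows "real (n choose k) * x / (fact n * B ^ n) = x / (fact k * B ^ k) / (fact (n - k) * B ^ (n - k))"
proof -
  have "B ^ n = B ^ k * B ^ (n - k)" using assms by (simp flip: power_add)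
  then show ?thesis using assms by (simp add: binomial_fact)
qed

lemma Abs_fps_binomial_convolution:
  fixes B :: real and c f g :: "nat \<Rightarrow> nat"
  assumes "B \<noteq> 0" "\<And>n. c n = (\<Sum>k\<le>n. (n choose k) * (f k * g (n - k)))"
  shows "Abs_fps (\<lambda>n. real (c n) / (fact n * B ^ n)) =
    Abs_fps (\<lambda>n. real (f n) / (fact n * B ^ n)) * Abs_fps (\<lambda>n. real (g n) / (fact n * B ^ n))"
proof (rule fps_ext)
  fix n
  have "real (c n) / (fact n * B ^ n) = (\<Sum>k\<le>n. real (n choose k) * (real (f k) * real (g (n - k))) / (fact n * B ^ n))"
    by (simp add: assms(2) sum_divide_distrib)
  also have "\<dots> = (\<Sum>k\<le>n. real (f k) / (fact k * B ^ k) * (real (g (n - k)) / (fact (n - k) * B ^ (n - k))))"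
    using assms(1) by (intro sum.cong refl) (subst binomial_term; simp)
  finally show "Abs_fps (\<lambda>n. real (c n) / (fact n * B ^ n)) $ n =
      (Abs_fps (\<lambda>n. real (f n) / (fact n * B ^ n)) * Abs_fps (\<lambda>n. real (g n) / (fact n * B ^ n))) $ n"
    by (simp add: fps_mult_nth atLeast0AtMost)
qed

lemma landau_fps_nth_0 [simp]: "landau_fps B d A $ 0 = 1"
  by (simp add: landau_fps_def)

lemma landau_fps_step:
  assumes B: "B \<ge> 1" and d: "d = 0 \<or> d = 1"
    and A: "A \<ge> -1" "n > 0 \<Longrightarrow> B * (int n - 1) + A + 1 \<ge> d"
  shows "landau_fps B d (A + 1) $ n =
    (\<Sum>k\<le>n. (1 / of_int B) ^ k / fact k * landau_fps B d (A + B * int k) $ (n - k))"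
proof -
  have "landau_fps B d (A + 1) $ n =
      (\<Sum>k\<le>n. real (n choose k) * real (landau_count B d (A + B * int k) (n - k)) / (fact n * of_int B ^ n))"
    by (simp add: landau_fps_def landau_count_step[OF assms] sum_divide_distrib)
  also have "\<dots> = (\<Sum>k\<le>n. (1 / of_int B) ^ k / fact k * landau_fps B d (A + B * int k) $ (n - k))"
    using B by (intro sum.cong refl) (subst binomial_term; simp add: landau_fps_def field_simps)
  finally show ?thesis .
qed

text \<open>In the recursion from A to A + 1 the term k = 0 has the same degree and the smaller
  excess A; all others have smaller degree and larger excess. Hence an outer induction on the
  degree, for all A, and an inner one on A.\<close>

lemma landau_fps_conv:
  assumes B: "B \<ge> 1" and d: "d = 0 \<or> d = 1" and A: "A \<ge> 0"
  shows "landau_fps B d A = texp (of_int A / of_int B) * landau_fps B d 0"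
proof (rule fps_ext)
  fix n show "landau_fps B d A $ n = (texp (of_int A / of_int B) * landau_fps B d 0) $ n"
    using A
  proof (induction n arbitrary: A rule: less_induct)
    case (less n)
    show ?case using less.prems
    proof (induction A rule: int_ge_induct)
      case base show ?case by simp
    next
      case (step A)
      have "landau_fps B d (A + B * int k) $ (n - k) =
          (texp (of_int A / of_int B + real k) * landau_fps B d 0) $ (n - k)" if "k \<le> n" for k
      proof (cases "k = 0")
        case True then show ?thesis using step by simp
      next
        case False
        have "of_int (A + B * int k) / of_int B = of_int A / of_int B + real k"
          using B by (simp add: field_simps)
        moreover have "A + B * int k \<ge> 0" "n - k < n" using step B False that by auto
        ultimately show ?thesis using less.IH[of "n - k" "A + B * int k"] by simp
      qed
      then have "(\<Sum>k\<le>n. (1 / of_int B) ^ k / fact k * landau_fps B d (A + B * int k) $ (n - k)) =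
          (texp (of_int A / of_int B + 1 / of_int B) * landau_fps B d 0) $ n"
        by (rule texp_step)
      moreover have "B * (int n - 1) + A + 1 \<ge> d" if "n > 0"
      proof -
        have "0 \<le> B * (int n - 1)" using that B by simp
        then show ?thesis using step d by linarith
      qed
      ultimately show ?case
        using landau_fps_step[OF B d, of A n] step by (simp add: add_divide_distrib)
    qed
  qed
qed

text \<open>The recursion from A = -1 to 0 is solved for its term k = 0, all other excesses being
  nonnegative. For d = 1 the recursion fails in degree 1, because a single entry equal to the bound
  0 violates the strict condition.\<close>

lemma landau_fps_minus_one:
  assumes B: "B \<ge> 1" and d: "d = 0 \<or> d = 1" and n: "n \<ge> 2"
  shows "landau_fps B d (-1) $ n = (texp (- 1 / of_int B) * landau_fps B d 0) $ n"
proof -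
  \<comment> \<open>\<open>c\<close> differs from the true values at most at k = 0, where it is the
    conjectured one; both families expand the same coefficient at excess 0.\<close>
  define c where "c k = (if k = 0 then (texp (- 1 / of_int B) * landau_fps B d 0) $ n
    else landau_fps B d (- 1 + B * int k) $ (n - k))" for k
  have "c k = (texp (- 1 / of_int B + real k) * landau_fps B d 0) $ (n - k)" for k
  proof (cases "k = 0")
    case False
    then have "1 \<le> B * int k" using B by (metis int_one_le_iff_zero_less mult_pos_pos of_nat_0_less_iff not_gr_zero zero_less_one_class.zero_less_one order_less_le_trans)
    moreover have "of_int (- 1 + B * int k) / of_int B = - 1 / of_int B + real k"
      using B by (simp add: field_simps)
    ultimately show ?thesis using False landau_fps_conv[OF B d, of "- 1 + B * int k"]
      by (simp add: c_def)
  qed (simp add: c_def)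
  then have "(\<Sum>k\<le>n. (1 / of_int B) ^ k / fact k * c k) =
      (texp (- 1 / of_int B + 1 / of_int B) * landau_fps B d 0) $ n"
    by (rule texp_step)
  also have "\<dots> = landau_fps B d (- 1 + 1) $ n" by simp
  also have "\<dots> = (\<Sum>k\<le>n. (1 / of_int B) ^ k / fact k * landau_fps B d (- 1 + B * int k) $ (n - k))"
  proof (rule landau_fps_step[OF B d])
    have "B * 1 \<le> B * (int n - 1)" using n B by (intro mult_left_mono) auto
    then show "d \<le> B * (int n - 1) + - 1 + 1" using B d by linarith
  qed simp
  finally have "(\<Sum>k\<le>n. (1 / of_int B) ^ k / fact k * (c k - landau_fps B d (- 1 + B * int k) $ (n - k))) = 0"
    by (simp add: right_diff_distrib sum_subtractf)
  also have "(\<Sum>k\<le>n. (1 / of_int B) ^ k / fact k * (c k - landau_fps B d (- 1 + B * int k) $ (n - k)))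
      = (\<Sum>k\<in>{0}. (1 / of_int B) ^ k / fact k * (c k - landau_fps B d (- 1 + B * int k) $ (n - k)))"
    by (rule sum.mono_neutral_right) (auto simp: c_def)
  finally show ?thesis by (simp add: c_def)
qed

section \<open>Closed forms of the tight, weak and strict series\<close>

lemma landau_fps_strict_mult_weak:
  assumes B: "B \<ge> 1"
  shows "landau_fps B 1 0 * landau_fps B 0 0 = abel (1 / of_int B - 1)"
proof -
  have "landau_fps B 1 0 * landau_fps B 0 0 =
      Abs_fps (\<lambda>n. real (nat (B * (int n - 1) + 1) ^ n) / (fact n * of_int B ^ n))"
    unfolding landau_fps_def using B
    by (subst Abs_fps_binomial_convolution[OF _ landau_count_minimal_decomposition[OF B]]) auto
  also have "\<dots> = abel (1 / of_int B - 1)"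
  proof (rule fps_ext)
    fix n
    \<comment> \<open>The box count (B (n - 1) + 1)^n divided by B^n is Abel's power with a = 1 / B
      - 1.\<close>
    have "real (nat (B * (int n - 1) + 1) ^ n) / of_int B ^ n = (1 / of_int B - 1 + real n) ^ n"
    proof (cases "n = 0")
      case False
      then have "0 \<le> B * (int n - 1)" using B by simp
      then have "real (nat (B * (int n - 1) + 1)) = of_int B * (real n - 1) + 1" by simp
      then have "real (nat (B * (int n - 1) + 1)) / of_int B = 1 / of_int B - 1 + real n"
        using B by (simp only: add_divide_distrib) simp
      then show ?thesis by (simp only: of_nat_power flip: power_divide)
    qed simp
    then show "Abs_fps (\<lambda>n. real (nat (B * (int n - 1) + 1) ^ n) / (fact n * of_int B ^ n)) $ n =
        abel (1 / of_int B - 1) $ n"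
      by (simp add: abel_def field_simps)
  qed
  finally show ?thesis .
qed

lemma landau_fps_tight:
  assumes B: "B \<ge> 1" and c: "c \<ge> 0"
  shows "landau_fps B 0 (c * B) = tight_fps B c * landau_fps B 1 0"
  unfolding landau_fps_def tight_fps_def using B
  by (intro Abs_fps_binomial_convolution landau_count_maximal_decomposition[OF B c]) auto

lemma landau_fps_weak_conv_tight:
  assumes "B \<ge> 1"
  shows "landau_fps B 0 0 = tight_fps B 0 * landau_fps B 1 0"
  using landau_fps_tight[OF assms, of 0] by simp

lemma tight_fps_1:
  assumes "B \<ge> 1"
  shows "tight_fps B 1 = fps_const (of_int B) * fps_deriv (tight_fps B 0)"
proof (rule fps_ext)
  fix n show "tight_fps B 1 $ n = (fps_const (of_int B) * fps_deriv (tight_fps B 0)) $ n"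
    using assms by (simp add: tight_fps_def tight_count_Suc divide_simps)
qed

text \<open>The weak series at excess B is exp T times the one at excess 0. Factoring both by the
  cut at the largest minimizer (c = 1 and c = 0) and cancelling the strict series gives B U' = exp T
  U for the tight series U.\<close>

lemma tight_fps_0:
  assumes B: "B \<ge> 1"
  shows "tight_fps B 0 = fexp (fps_const (1 / of_int B) * (tree - fps_const (1/2) * tree ^ 2))"
proof (rule fps_linear_ode_unique)
  have "tight_fps B 1 * landau_fps B 1 0 = landau_fps B 0 (1 * B)"
    by (rule landau_fps_tight[OF B, symmetric]) simp
  also have "\<dots> = texp 1 * landau_fps B 0 0"
    using landau_fps_conv[OF B, of 0 "1 * B"] B by simp
  also have "\<dots> = (texp 1 * tight_fps B 0) * landau_fps B 1 0"
    by (simp only: landau_fps_weak_conv_tight[OF B] mult.assoc)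
  finally have "tight_fps B 1 * landau_fps B 1 0 = (texp 1 * tight_fps B 0) * landau_fps B 1 0" .
  moreover have "landau_fps B 1 0 \<noteq> 0" using landau_fps_nth_0[of B 1 0] by force
  ultimately have "tight_fps B 1 = texp 1 * tight_fps B 0" by simp
  moreover have const_inverse: "fps_const (1 / of_int B :: real) * fps_const (of_int B) = 1"
    using B by simp
  ultimately have "fps_const (1 / of_int B) * (fps_const (of_int B) * fps_deriv (tight_fps B 0)) =
      fps_const (1 / of_int B) * (texp 1 * tight_fps B 0)"
    by (simp only: tight_fps_1[OF B])
  then show "fps_deriv (tight_fps B 0) = (fps_const (1 / of_int B) * texp 1) * tight_fps B 0"
    using const_inverse by (simp only: mult.assoc[symmetric] mult_1_left)
  have "fps_deriv (tree - fps_const (1/2) * tree ^ 2) = texp 1"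
    unfolding fps_deriv_tree_mult[symmetric]
    by (simp add: power2_eq_square algebra_simps)
  then show "fps_deriv (fexp (fps_const (1 / of_int B) * (tree - fps_const (1/2) * tree ^ 2))) =
      (fps_const (1 / of_int B) * texp 1) * fexp (fps_const (1 / of_int B) * (tree - fps_const (1/2) * tree ^ 2))"
    by (subst fps_deriv_fexp) (simp_all add: power2_eq_square)
qed (simp add: tight_fps_def)

text \<open>With \<open>T\<close> for \<^const>\<open>tree\<close>, this is \<open>(1 - T)^(-1/2) exp (- T / 2 + T^2 / 4)\<close>; note \<open>1 / (1 - T)\<close> is \<open>abel 0\<close>.\<close>

definition kfps :: "real fps" where
  "kfps = fexp (fps_integral0 (fps_deriv tree * (fps_const (1/2) * (tree * abel 0 + tree))))"

lemma kfps_nth_0 [simp]: "kfps $ 0 = 1"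
  by (simp add: kfps_def)

lemma fps_deriv_kfps: "fps_deriv kfps = fps_deriv tree * (fps_const (1/2) * (tree * abel 0 + tree)) * kfps"
  unfolding kfps_def by (subst fps_deriv_fexp) (simp_all add: fps_deriv_fps_integral)

lemma abel_0_conv_kfps: "abel 0 = kfps ^ 2 * fexp (tree - fps_const (1/2) * tree ^ 2)"
proof -
  define E where "E = fexp (tree - fps_const (1/2) * tree ^ 2)"
  define T' where "T' = fps_deriv tree"
  define K' where "K' = T' * (fps_const (1/2) * (tree * abel 0 + tree))"
  have a: "abel 0 * (1 - tree) = 1" using abel_mult[of 0] by simp
  have "2 * K' * (1 - tree) = T' * (tree * (abel 0 * (1 - tree)) + tree * (1 - tree))"
    by (simp add: K'_def algebra_simps numeral_fps_const)
  then have 2: "2 * K' * (1 - tree) = T' * (tree + tree * (1 - tree))" unfolding a by simp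
  have E': "fps_deriv E = T' * (1 - tree) * E"
    unfolding E_def T'_def
    by (subst fps_deriv_fexp) (simp_all add: power2_eq_square algebra_simps)
  have K: "fps_deriv kfps = K' * kfps" by (simp add: fps_deriv_kfps K'_def T'_def)
  \<comment> \<open>No root is extracted: the product that should be 1 has derivative 0.\<close>
  have "fps_deriv (kfps ^ 2 * E * (1 - tree)) =
      kfps ^ 2 * E * (2 * K' * (1 - tree) + T' * (1 - tree) * (1 - tree) - T')"
    by (simp add: power2_eq_square K E' T'_def algebra_simps)
  moreover have "2 * K' * (1 - tree) + T' * (1 - tree) * (1 - tree) - T' = 0"
    unfolding 2 by (simp add: algebra_simps)
  ultimately have deriv: "fps_deriv (kfps ^ 2 * E * (1 - tree)) = 0"
    by (simp only: mult_zero_right)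
  have "kfps ^ 2 * E * (1 - tree) = 1"
  proof (rule fps_linear_ode_unique)
    show "fps_deriv (kfps ^ 2 * E * (1 - tree)) = 0 * (kfps ^ 2 * E * (1 - tree))"
      by (simp only: deriv mult_zero_left)
    show "fps_deriv 1 = 0 * (1 :: real fps)" by simp
    show "(kfps ^ 2 * E * (1 - tree)) $ 0 = 1 $ 0" by (simp add: E_def power2_eq_square)
  qed
  then have "abel 0 * (1 - tree) = kfps ^ 2 * E * (1 - tree)" using a by simp
  then show ?thesis using one_minus_tree_nonzero unfolding E_def by simp
qed

lemma fps_eq_of_squares_eq:
  fixes F G :: "real fps"
  assumes "F ^ 2 = G ^ 2" "F $ 0 = 1" "G $ 0 = 1"
  shows "F = G"
proof -
  have "F \<noteq> - G" using assms(2,3) by (metis fps_neg_nth one_neq_neg_one)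
  then show ?thesis using assms(1) by (simp add: power2_eq_iff)
qed

definition omega :: "real fps" where
  "omega = kfps * texp (-1)"

text \<open>Multiplying weak = tight * strict by the weak series and inserting the Abel series for
  strict * weak gives a known square; the constant term 1 fixes the sign of the root.\<close>

lemma landau_fps_weak:
  assumes B: "B \<ge> 1"
  shows "landau_fps B 0 0 = omega * fexp (fps_const (1 + 1 / of_int B) * tau)"
proof (rule fps_eq_of_squares_eq)
  define s :: real where "s = 1 / of_int B"
  have [simp]: "(fps_const a * tree) $ 0 = 0" "(fps_const a * tree ^ 2) $ 0 = 0" for a by simp_all
  have "landau_fps B 0 0 ^ 2 = tight_fps B 0 * (landau_fps B 1 0 * landau_fps B 0 0)"
    using landau_fps_weak_conv_tight[OF B] by (simp add: power2_eq_square mult_ac)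
  also have "\<dots> = tight_fps B 0 * (texp (s - 1) * abel 0)"
    unfolding landau_fps_strict_mult_weak[OF B] s_def by (subst abel_conv) simp
  also have "\<dots> = kfps ^ 2 * (fexp (fps_const s * (tree - fps_const (1/2) * tree ^ 2)) *
      fexp (fps_const (s - 1) * tree) * fexp (tree - fps_const (1/2) * tree ^ 2))"
    by (simp add: tight_fps_0[OF B] s_def texp_def abel_0_conv_kfps mult_ac)
  also have "fexp (fps_const s * (tree - fps_const (1/2) * tree ^ 2)) *
      fexp (fps_const (s - 1) * tree) * fexp (tree - fps_const (1/2) * tree ^ 2) =
      fexp ((fps_const s * (tree - fps_const (1/2) * tree ^ 2)) + fps_const (s - 1) * tree +
        (tree - fps_const (1/2) * tree ^ 2))"
    by (simp add: fexp_add)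
  \<comment> \<open>The exponent is twice - T + (1 + s) tau. The first summand goes into
    \<open>omega\<close>, the second will be expanded in powers of 1 + s = 1 + 1 / B.\<close>
  also have "(fps_const s * (tree - fps_const (1/2) * tree ^ 2)) + fps_const (s - 1) * tree +
        (tree - fps_const (1/2) * tree ^ 2) =
      (fps_const (-1) * tree + fps_const (1 + s) * tau) + (fps_const (-1) * tree + fps_const (1 + s) * tau)"
    by (rule fps_ext) (simp add: tau_def, simp add: field_simps)
  also have "kfps ^ 2 * fexp \<dots> = (kfps * fexp (fps_const (-1) * tree + fps_const (1 + s) * tau)) ^ 2"
    by (subst fexp_add) (simp_all add: power2_eq_square mult_ac)
  also have "kfps * fexp (fps_const (-1) * tree + fps_const (1 + s) * tau) =
      omega * fexp (fps_const (1 + s) * tau)"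
    by (subst fexp_add) (simp_all add: omega_def texp_def mult_ac)
  finally show "landau_fps B 0 0 ^ 2 = (omega * fexp (fps_const (1 + 1 / of_int B) * tau)) ^ 2"
    by (simp add: s_def)
qed (simp_all add: omega_def)

text \<open>For B = 1 the Abel parameter 1 / B - 1 vanishes. The analytic series \<open>kfps\<close>
  thereby gets a combinatorial meaning from which signs can be read off.\<close>

lemma landau_fps_1_strict: "landau_fps 1 1 0 = kfps"
proof (rule fps_eq_of_squares_eq)
  have "tight_fps 1 0 * landau_fps 1 1 0 ^ 2 = abel 0"
    using landau_fps_strict_mult_weak[of 1] landau_fps_weak_conv_tight[of 1]
    by (simp add: power2_eq_square mult_ac)
  also have "\<dots> = tight_fps 1 0 * kfps ^ 2"
    by (simp add: abel_0_conv_kfps tight_fps_0 mult_ac)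
  finally have "tight_fps 1 0 * landau_fps 1 1 0 ^ 2 = tight_fps 1 0 * kfps ^ 2" .
  moreover have "tight_fps 1 0 $ 0 = 1" by (simp add: tight_fps_def)
  then have "tight_fps 1 0 \<noteq> 0" by force
  ultimately show "landau_fps 1 1 0 ^ 2 = kfps ^ 2" by simp
qed simp_all

text \<open>The factor exp (- T) hides the sign, but multiplying by it lowers the excess from 0 to
  -1: n! times the coefficient counts strict Landau vectors for B = 1 with entries at most n -
  2.\<close>

lemma omega_nth_nonneg:
  assumes "n \<ge> 2"
  shows "omega $ n \<ge> 0"
proof -
  have "omega $ n = landau_fps 1 1 (-1) $ n"
    using landau_fps_minus_one[of 1 1 n] assms by (simp add: omega_def landau_fps_1_strict mult.commute)
  then show ?thesis by (simp add: landau_fps_def)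
qed

text \<open>No B occurs: along the dilates \<alpha> = A / B = (a - 1) / b stays fixed, so these
  numbers do not change with t.\<close>

definition magic_coeff :: "real \<Rightarrow> nat \<Rightarrow> nat \<Rightarrow> real" where
  "magic_coeff \<alpha> n j = fact n / fact j * (tau ^ j * (texp \<alpha> * omega)) $ n"

lemma landau_count_magic:
  assumes B: "B \<ge> 1" and A: "A \<ge> 0" "of_int A = \<alpha> * of_int B"
  shows "real (landau_count B 0 A n) =
    (\<Sum>j\<le>n. magic_coeff \<alpha> n j * of_int B ^ (n - j) * (of_int B + 1) ^ j)"
proof -
  have "real (landau_count B 0 A n) / (fact n * of_int B ^ n) = landau_fps B 0 A $ n"
    by (simp add: landau_fps_def)
  also have "\<dots> = (fexp (fps_const (1 + 1 / of_int B) * tau) * (texp \<alpha> * omega)) $ n"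
    using landau_fps_conv[OF B, of 0 A] A B by (simp add: landau_fps_weak[OF B] mult_ac)
  also have "\<dots> = (\<Sum>j\<le>n. (1 + 1 / of_int B) ^ j / fact j * (tau ^ j * (texp \<alpha> * omega)) $ n)"
    by (rule fexp_mult_nth) simp
  finally have "real (landau_count B 0 A n) =
      fact n * of_int B ^ n * (\<Sum>j\<le>n. (1 + 1 / of_int B) ^ j / fact j * (tau ^ j * (texp \<alpha> * omega)) $ n)"
    using B by (simp add: field_simps)
  also have "\<dots> = (\<Sum>j\<le>n. magic_coeff \<alpha> n j * of_int B ^ (n - j) * (of_int B + 1) ^ j)"
    unfolding sum_distrib_left
  proof (intro sum.cong refl)
    fix j assume j: "j \<in> {..n}"
    have "of_int B ^ n * (1 + 1 / of_int B) ^ j = (of_int B ^ (n - j) * (of_int B + 1) ^ j :: real)"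
    proof -
      have "(of_int B :: real) ^ n = of_int B ^ (n - j) * of_int B ^ j"
        using j by (simp flip: power_add)
      moreover have "(of_int B :: real) ^ j * (1 + 1 / of_int B) ^ j = (of_int B + 1) ^ j"
        using B by (simp add: distrib_left flip: power_mult_distrib)
      ultimately show ?thesis by (simp add: mult.assoc)
    qed
    then have "fact n / fact j * (tau ^ j * (texp \<alpha> * omega)) $ n * (of_int B ^ n * (1 + 1 / of_int B) ^ j) =
       magic_coeff \<alpha> n j * (of_int B ^ (n - j) * (of_int B + 1) ^ j)"
      by (simp add: magic_coeff_def)
    then show "fact n * of_int B ^ n * ((1 + 1 / of_int B) ^ j / fact j * (tau ^ j * (texp \<alpha> * omega)) $ n) =
       magic_coeff \<alpha> n j * of_int B ^ (n - j) * (of_int B + 1) ^ j"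
      by (simp add: mult_ac)
  qed
  finally show ?thesis .
qed

section \<open>Magic positivity\<close>

definition fps_nonneg :: "real fps \<Rightarrow> bool" where
  "fps_nonneg F \<longleftrightarrow> (\<forall>n. F $ n \<ge> 0)"

lemma fps_nonnegI: "(\<And>n. F $ n \<ge> 0) \<Longrightarrow> fps_nonneg F"
  and fps_nonnegD: "fps_nonneg F \<Longrightarrow> F $ n \<ge> 0"
  by (simp_all add: fps_nonneg_def)

lemma fps_nonneg_add: "fps_nonneg F \<Longrightarrow> fps_nonneg G \<Longrightarrow> fps_nonneg (F + G)"
  by (simp add: fps_nonneg_def)

lemma fps_nonneg_mult: "fps_nonneg F \<Longrightarrow> fps_nonneg G \<Longrightarrow> fps_nonneg (F * G)"
  by (auto simp: fps_nonneg_def fps_mult_nth intro!: sum_nonneg)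

lemma fps_nonneg_const: "c \<ge> 0 \<Longrightarrow> fps_nonneg (fps_const c)"
  by (simp add: fps_nonneg_def)

lemma fps_nonneg_X: "fps_nonneg fps_X"
  by (simp add: fps_nonneg_def fps_X_nth)

lemma fps_nonneg_power: "fps_nonneg F \<Longrightarrow> fps_nonneg (F ^ k)"
proof (induction k)
  case 0 then show ?case by (simp add: fps_nonneg_def fps_one_nth)
next
  case (Suc k) then show ?case by (simp add: fps_nonneg_mult)
qed

lemma fps_nonneg_deriv: "fps_nonneg F \<Longrightarrow> fps_nonneg (fps_deriv F)"
  by (simp add: fps_nonneg_def)

lemma fps_nonneg_integral0: "fps_nonneg F \<Longrightarrow> fps_nonneg (fps_integral0 F)"
  by (simp add: fps_nonneg_def fps_integral_def)

lemma fps_nonneg_fexp: "fps_nonneg F \<Longrightarrow> fps_nonneg (fexp F)"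
  using fps_nonneg_power[of F]
  by (auto simp: fps_nonneg_def fexp_def fps_compose_nth intro!: sum_nonneg)

lemma fps_nonneg_abel: "a \<ge> 0 \<Longrightarrow> fps_nonneg (abel a)"
  by (simp add: fps_nonneg_def abel_def)

lemma fps_nonneg_tree: "fps_nonneg tree"
proof (rule fps_nonnegI)
  fix n show "tree $ n \<ge> 0" by (cases "n = 0") (simp_all add: tree_nth)
qed

lemma fps_nonneg_tau: "fps_nonneg tau"
proof (rule fps_nonnegI)
  fix n show "tau $ n \<ge> 0" by (cases "n = 0") (simp_all add: tau_nth)
qed

text \<open>The logarithmic derivative T' (T / (1 - T) + T) / 2 has nonnegative coefficients;
  defining \<open>kfps\<close> by integrating it makes this visible.\<close>

lemma fps_nonneg_kfps: "fps_nonneg kfps"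
  unfolding kfps_def
  by (intro fps_nonneg_fexp fps_nonneg_integral0 fps_nonneg_mult fps_nonneg_deriv fps_nonneg_tree
      fps_nonneg_const fps_nonneg_add fps_nonneg_abel) simp_all

section \<open>Coefficients of low degree\<close>

lemma texp_nth_1: "texp a $ 1 = a"
  using arg_cong[OF fps_deriv_texp[of a], of "\<lambda>F. F $ 0"]
  by (simp add: fps_deriv_tree abel_def)

lemma texp_nth_2: "texp a $ 2 = a + a ^ 2 / 2"
  using arg_cong[OF fps_deriv_texp[of a], of "\<lambda>F. F $ 1"] texp_nth_1[of a]
  by (simp add: fps_deriv_tree abel_def fps_mult_nth_1 numeral_2_eq_2 power2_eq_square algebra_simps)

lemma kfps_nth_1: "kfps $ 1 = 0"
  using arg_cong[OF fps_deriv_kfps, of "\<lambda>F. F $ 0"] by simp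

lemma kfps_nth_2: "kfps $ 2 = 1 / 2"
  using arg_cong[OF fps_deriv_kfps, of "\<lambda>F. F $ 1"] tree_nth[of 1]
  by (simp add: fps_deriv_tree abel_def fps_mult_nth_1 numeral_2_eq_2)

lemma fps_mult_nth_2: "(F * G) $ 2 = F $ 0 * G $ 2 + F $ 1 * G $ 1 + F $ 2 * (G $ 0 :: real)"
  by (simp add: fps_mult_nth numeral_2_eq_2)

lemma omega_nth_0: "omega $ 0 = 1" and omega_nth_1: "omega $ 1 = -1" and omega_nth_2: "omega $ 2 = 0"
  using kfps_nth_1 kfps_nth_2
  by (simp_all add: omega_def fps_mult_nth_1 fps_mult_nth_2 texp_nth_1[simplified] texp_nth_2)

lemma tau_nth_1: "tau $ 1 = 1" and tau_nth_2: "tau $ 2 = 3 / 4"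
  by (simp_all add: tau_nth)

section \<open>Nonnegativity of the expansion coefficients for n \<ge> 3\<close>

lemma tau_nth_mono:
  assumes "m \<ge> 2"
  shows "tau $ m \<le> tau $ Suc m"
proof -
  obtain k where m: "m = Suc (Suc k)" using assms by (metis Suc_le_D numeral_2_eq_2 le_SucE Suc_le_mono)
  \<comment> \<open>With m = k + 2 both coefficients get the denominator 2 m!, and the numerators
    are (m + 1) m^k and (m + 2) (m + 1)^k.\<close>
  have "tau $ m = (real m + 1) * real m ^ k / (2 * fact m)"
    by (subst tau_nth) (simp_all add: m)
  also have "\<dots> \<le> (real m + 2) * (real m + 1) ^ k / (2 * fact m)"
    by (intro divide_right_mono mult_mono power_mono) simp_all
  also have "\<dots> = tau $ Suc m"
  proof -
    have "(real m + 2) * (real m + 1) ^ k / (2 * fact m) =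
        ((real m + 2) * (real m + 1) ^ k * (real m + 1) ^ 2) / (2 * fact m * (real m + 1) ^ 2)"
      by simp
    also have "(real m + 1) ^ k * (real m + 1) ^ 2 = (real m + 1) ^ m"
      by (simp add: m flip: power_add)
    then have "(real m + 2) * (real m + 1) ^ k * (real m + 1) ^ 2 = (real m + 2) * (real m + 1) ^ m"
      by (simp only: mult.assoc)
    also have "2 * fact m * (real m + 1) ^ 2 = 2 * (real m + 1) * fact (Suc m)"
      by (simp add: power2_eq_square algebra_simps)
    finally show ?thesis by (subst tau_nth) (simp_all add: add.commute)
  qed
  finally show ?thesis .
qed

text \<open>The drop of the coefficients of \<open>tau\<close> from 1 in degree 1 to 3/4 in degree 2
  is the only one, so (1 - X) tau = X - X^2 / 4 + \<rho> with \<rho> \<ge> 0. In higher powers a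
  further factor \<open>tau\<close> absorbs the term - X^2 / 4.\<close>

lemma tau_power_nth_mono:
  assumes "n \<ge> 3" "j \<ge> 1"
  shows "(tau ^ j) $ n \<ge> (fps_X * tau ^ j) $ n"
proof (cases "j = 1")
  case True
  then show ?thesis using tau_nth_mono[of "n - 1"] assms by (cases n) auto
next
  case False
  then obtain i where j: "j = i + 2" using assms(2) by (metis add.commute le_Suc_ex le_antisym not_less_eq_eq one_add_one plus_1_eq_Suc)
  define \<rho> where "\<rho> = (1 - fps_X) * tau - fps_X + fps_const (1/4) * fps_X ^ 2"
  have "fps_nonneg \<rho>"
  proof (rule fps_nonnegI)
    fix n
    consider "n = 0" | "n = 1" | "n = 2" | m where "n = Suc m" "m \<ge> 2"
      by (metis One_nat_def Suc_1 not_less_eq_eq not0_implies_Suc le_zero_eq le_Suc_eq)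
    then show "\<rho> $ n \<ge> 0"
    proof cases
      case 4
      then show ?thesis using tau_nth_mono[of m]
        by (simp add: \<rho>_def algebra_simps fps_X_power_nth fps_X_nth)
    qed (use tau_nth_1 tau_nth_2 in \<open>simp_all add: \<rho>_def algebra_simps fps_X_power_nth fps_X_nth numeral_2_eq_2\<close>)
  qed
  moreover have "fps_nonneg (tau - fps_const (1/4) * (fps_X * tau))"
  proof (rule fps_nonnegI)
    fix n
    consider "n = 0" | "n = 1" | "n = 2" | m where "n = Suc m" "m \<ge> 2"
      by (metis One_nat_def Suc_1 not_less_eq_eq not0_implies_Suc le_zero_eq le_Suc_eq)
    then show "(tau - fps_const (1/4) * (fps_X * tau)) $ n \<ge> 0"
    proof cases
      case 4
      then show ?thesis using tau_nth_mono[of m] fps_nonnegD[OF fps_nonneg_tau, of m]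
        by simp
    qed (use tau_nth_1 tau_nth_2 in \<open>simp_all add: numeral_2_eq_2\<close>)
  qed
  ultimately have "fps_nonneg ((\<rho> * tau + fps_X * (tau - fps_const (1/4) * (fps_X * tau))) * tau ^ i)"
    by (intro fps_nonneg_mult fps_nonneg_add fps_nonneg_power fps_nonneg_tau fps_nonneg_X)
  moreover have "(\<rho> * tau + fps_X * (tau - fps_const (1/4) * (fps_X * tau))) * tau ^ i = tau ^ j - fps_X * tau ^ j"
    by (simp add: j \<rho>_def algebra_simps power2_eq_square power_add)
  ultimately show ?thesis using fps_nonnegD[of "tau ^ j - fps_X * tau ^ j" n] by simp
qed

text \<open>Splitting omega = (omega - 1 + X) + (1 - X) isolates its only negative coefficient;
  \<open>tau_power_nth_mono\<close> controls the second part. In degree 2 with j = 1 the value is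
  3/4 - 1 = -1/4, the source of the exceptional case.\<close>

lemma omega_tau_nonneg:
  assumes "n \<ge> 3"
  shows "(omega * tau ^ j) $ n \<ge> 0"
proof (cases "j = 0")
  case True then show ?thesis using omega_nth_nonneg[of n] assms by simp
next
  case False
  have "fps_nonneg (omega - 1 + fps_X)"
  proof (rule fps_nonnegI)
    fix n :: nat
    consider "n = 0" | "n = 1" | "n \<ge> 2" by linarith
    then show "(omega - 1 + fps_X) $ n \<ge> 0"
      by cases (use omega_nth_0 omega_nth_1 omega_nth_nonneg[of n] in \<open>auto simp: fps_X_nth\<close>)
  qed
  then have "fps_nonneg ((omega - 1 + fps_X) * tau ^ j)"
    by (intro fps_nonneg_mult fps_nonneg_power fps_nonneg_tau)
  moreover have "omega * tau ^ j = (omega - 1 + fps_X) * tau ^ j + (tau ^ j - fps_X * tau ^ j)"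
    by (simp add: algebra_simps)
  ultimately show ?thesis
    using tau_power_nth_mono[of n j] assms False by (simp add: fps_nonneg_def)
qed

text \<open>exp (\<alpha> T) is expanded in powers of T. A single factor T removes exp (- T) from
  \<open>omega\<close>, as T omega = X kfps, so only the term k = 0 is delicate.\<close>

lemma magic_coeff_nonneg:
  assumes "n \<ge> 3" "\<alpha> \<ge> 0"
  shows "magic_coeff \<alpha> n j \<ge> 0"
proof -
  have "(tau ^ j * (texp \<alpha> * omega)) $ n = (texp \<alpha> * (omega * tau ^ j)) $ n"
    by (simp add: mult_ac)
  also have "\<dots> = (\<Sum>k\<le>n. \<alpha> ^ k / fact k * (tree ^ k * (omega * tau ^ j)) $ n)"
    unfolding texp_def by (rule fexp_mult_nth) simp
  also have "\<dots> \<ge> 0"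
  proof (intro sum_nonneg mult_nonneg_nonneg)
    fix k
    show "(tree ^ k * (omega * tau ^ j)) $ n \<ge> 0"
    proof (cases k)
      case 0 then show ?thesis using omega_tau_nonneg[OF assms(1)] by simp
    next
      case (Suc i)
      have "tree * omega = fps_X * (texp 1 * texp (-1)) * kfps"
        by (subst tree_eq) (simp add: omega_def mult_ac)
      also have "texp 1 * texp (-1) = 1" by (simp flip: texp_add)
      finally have "tree * omega = fps_X * kfps" by simp
      moreover have "tree ^ k * (omega * tau ^ j) = tree ^ i * (tree * omega) * tau ^ j"
        using Suc by (simp add: mult_ac)
      moreover have "fps_nonneg (tree ^ i * (fps_X * kfps) * tau ^ j)"
        by (intro fps_nonneg_mult fps_nonneg_power fps_nonneg_tree fps_nonneg_tau fps_nonneg_X fps_nonneg_kfps)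
      ultimately show ?thesis by (metis fps_nonnegD)
    qed
  qed (use assms in simp)
  finally show ?thesis by (simp add: magic_coeff_def)
qed

lemma magic_coeff_1: "magic_coeff \<alpha> 1 0 = \<alpha> - 1" "magic_coeff \<alpha> 1 1 = 1"
  using omega_nth_0 omega_nth_1 tau_nth_1 texp_nth_1[of \<alpha>]
  by (simp_all add: magic_coeff_def fps_mult_nth_1)

lemma magic_coeff_2:
  "magic_coeff \<alpha> 2 0 = \<alpha> ^ 2" "magic_coeff \<alpha> 2 1 = 2 * \<alpha> - 1 / 2" "magic_coeff \<alpha> 2 2 = 1"
  using omega_nth_0 omega_nth_1 omega_nth_2 tau_nth_1 tau_nth_2 texp_nth_1[of \<alpha>] texp_nth_2[of \<alpha>]
  by (simp_all add: magic_coeff_def fps_mult_nth_1 fps_mult_nth_2 power2_eq_square[of tau] algebra_simps)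

section \<open>Closure properties of magic positivity and the cases of n\<close>

definition magic_function :: "nat \<Rightarrow> (real \<Rightarrow> real) \<Rightarrow> bool" where
  "magic_function n f \<longleftrightarrow> (\<exists>\<mu> :: nat \<Rightarrow> real. (\<forall>i\<le>n. \<mu> i \<ge> 0) \<and>
     (\<forall>t. f t = (\<Sum>i\<le>n. \<mu> i * t ^ i * (t + 1) ^ (n - i))))"

lemma magic_function_1: "magic_function 0 (\<lambda>_. 1)"
  unfolding magic_function_def by (intro exI[of _ "\<lambda>_. 1"]) simp

lemma magic_function_cmult:
  assumes "magic_function n f" "c \<ge> 0"
  shows "magic_function n (\<lambda>t. c * f t)"
proof -
  obtain \<mu> where "\<forall>i\<le>n. \<mu> i \<ge> 0" "\<forall>t. f t = (\<Sum>i\<le>n. \<mu> i * t ^ i * (t + 1) ^ (n - i))"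
    using assms(1) unfolding magic_function_def by auto
  then show ?thesis unfolding magic_function_def using assms(2)
    by (intro exI[of _ "\<lambda>i. c * \<mu> i"]) (simp add: sum_distrib_left mult.assoc)
qed

lemma magic_function_add:
  assumes "magic_function n f" "magic_function n g"
  shows "magic_function n (\<lambda>t. f t + g t)"
proof -
  obtain \<mu> \<nu> where "\<forall>i\<le>n. \<mu> i \<ge> 0" "\<forall>t. f t = (\<Sum>i\<le>n. \<mu> i * t ^ i * (t + 1) ^ (n - i))"
    "\<forall>i\<le>n. \<nu> i \<ge> 0" "\<forall>t. g t = (\<Sum>i\<le>n. \<nu> i * t ^ i * (t + 1) ^ (n - i))"
    using assms unfolding magic_function_def by auto
  then show ?thesis unfolding magic_function_def
    by (intro exI[of _ "\<lambda>i. \<mu> i + \<nu> i"]) (simp add: sum.distrib distrib_right)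
qed

lemma magic_function_sum:
  assumes "finite I" "\<And>j. j \<in> I \<Longrightarrow> magic_function n (f j)"
  shows "magic_function n (\<lambda>t. \<Sum>j\<in>I. f j t)"
  using assms
proof (induction I)
  case empty
  show ?case unfolding magic_function_def by (intro exI[of _ "\<lambda>_. 0"]) simp
next
  case (insert j I) then show ?case by (simp add: magic_function_add)
qed

lemma magic_function_mult_t:
  assumes "magic_function n f"
  shows "magic_function (Suc n) (\<lambda>t. t * f t)"
proof -
  obtain \<mu> where "\<forall>i\<le>n. \<mu> i \<ge> 0" "\<forall>t. f t = (\<Sum>i\<le>n. \<mu> i * t ^ i * (t + 1) ^ (n - i))"
    using assms unfolding magic_function_def by auto
  then show ?thesis unfolding magic_function_def
    by (intro exI[of _ "\<lambda>i. if i = 0 then 0 else \<mu> (i - 1)"])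
       (auto simp: sum.atMost_Suc_shift sum_distrib_left mult_ac simp del: sum.atMost_Suc)
qed

lemma magic_function_mult_t_plus_1:
  assumes "magic_function n f"
  shows "magic_function (Suc n) (\<lambda>t. (t + 1) * f t)"
proof -
  obtain \<mu> where "\<forall>i\<le>n. \<mu> i \<ge> 0" "\<forall>t. f t = (\<Sum>i\<le>n. \<mu> i * t ^ i * (t + 1) ^ (n - i))"
    using assms unfolding magic_function_def by auto
  then show ?thesis unfolding magic_function_def
    by (intro exI[of _ "\<lambda>i. if i = Suc n then 0 else \<mu> i"])
       (auto simp: sum_distrib_left Suc_diff_le mult_ac intro!: sum.cong)
qed

text \<open>For b \<ge> 1 the factor b t + 1 is (b - 1) t + (t + 1), a nonnegative combination of
  the two basis factors.\<close>

lemma magic_function_linear: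
  assumes "b \<ge> 1" "j \<le> n"
  shows "magic_function n (\<lambda>t. (b * t) ^ (n - j) * (b * t + 1) ^ j)"
proof -
  have power: "magic_function j (\<lambda>t. (b * t + 1) ^ j)" for j
  proof (induction j)
    case 0 then show ?case by (simp add: magic_function_1)
  next
    case (Suc j)
    have "magic_function (Suc j) (\<lambda>t. (b - 1) * (t * (b * t + 1) ^ j) + (t + 1) * (b * t + 1) ^ j)"
      using Suc assms(1)
      by (intro magic_function_add magic_function_cmult magic_function_mult_t magic_function_mult_t_plus_1) auto
    then show ?case by (simp add: algebra_simps)
  qed
  have "magic_function (k + j) (\<lambda>t. (b * t) ^ k * (b * t + 1) ^ j)" for k
  proof (induction k)
    case 0 then show ?case using power by simp
  next
    case (Suc k)
    have "magic_function (Suc (k + j)) (\<lambda>t. b * (t * ((b * t) ^ k * (b * t + 1) ^ j)))"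
      using Suc assms(1) by (intro magic_function_cmult magic_function_mult_t) auto
    then show ?case by (simp add: mult_ac)
  qed
  from this[of "n - j"] assms(2) show ?thesis by simp
qed

definition ehr_function :: "nat \<Rightarrow> nat \<Rightarrow> nat \<Rightarrow> real \<Rightarrow> real" where
  "ehr_function n a b t = (\<Sum>j\<le>n. magic_coeff ((real a - 1) / real b) n j *
     ((real b * t) ^ (n - j) * (real b * t + 1) ^ j))"

lemma landau_count_ehr_function:
  assumes "a > 0" "b > 0" "t > 0"
  shows "real (landau_count (int t * int b) 0 (int t * (int a - 1)) n) = ehr_function n a b (real t)"
proof -
  have tb: "1 \<le> int t * int b" using assms by (metis of_nat_0_less_iff of_nat_mult int_one_le_iff_zero_less zero_less_mult_iff)
  have "real (landau_count (int t * int b) 0 (int t * (int a - 1)) n) =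
    (\<Sum>j\<le>n. magic_coeff ((real a - 1) / real b) n j * of_int (int t * int b) ^ (n - j) *
       (of_int (int t * int b) + 1) ^ j)"
    using assms by (intro landau_count_magic[OF tb]) (auto simp: field_simps)
  also have "\<dots> = ehr_function n a b (real t)"
    unfolding ehr_function_def by (intro sum.cong) (simp_all add: mult_ac)
  finally show ?thesis .
qed

lemma ehr_function_1:
  assumes "b > 0"
  shows "ehr_function 1 a b t = (real a - 1) * t + 1"
  using magic_coeff_1[of "(real a - 1) / real b"] assms
  by (simp add: ehr_function_def) (simp add: field_simps)

lemma ehr_function_2:
  assumes "b > 0"
  shows "ehr_function 2 a b t = 1 + (3 * real b / 2 + 2 * (real a - 1)) * t +
    ((real a - 1) ^ 2 + 2 * (real a - 1) * real b + real b ^ 2 / 2) * t ^ 2"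
proof -
  define \<alpha> where "\<alpha> = (real a - 1) / real b"
  have a: "real a - 1 = \<alpha> * real b" using assms by (simp add: \<alpha>_def)
  have "ehr_function 2 a b t = magic_coeff \<alpha> 2 0 * (real b * t) ^ 2 +
      magic_coeff \<alpha> 2 1 * (real b * t * (real b * t + 1)) + magic_coeff \<alpha> 2 2 * (real b * t + 1) ^ 2"
    by (simp add: ehr_function_def \<alpha>_def numeral_2_eq_2)
  then show ?thesis
    unfolding magic_coeff_2 a by (simp add: power2_eq_square field_simps)
qed

text \<open>For n = a = 1 the polytope is a point, hence the degree 0 there. For n \<le> 2 some
  \<open>magic_coeff\<close> can be negative, so these cases use explicit polynomials in t.\<close>

lemma magic_function_ehr_function:
  assumes ab: "a > 0" "b > 0" and n: "n > 0" "(n, a, b) \<noteq> (2, 1, 1)"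
  shows "magic_function (if n = 1 \<and> a = 1 then 0 else n) (ehr_function n a b)"
proof -
  consider "n = 1" "a = 1" | "n = 1" "a \<ge> 2" | "n = 2" | "n \<ge> 3"
    using ab n by linarith
  then show ?thesis
  proof cases
    case 1
    then have "ehr_function n a b = (\<lambda>_. 1)" using ab ehr_function_1[of b] by auto
    then show ?thesis using 1 magic_function_1 by simp
  next
    case 2
    have "magic_function 1 (\<lambda>t. (real a - 1) * t + 1)"
      unfolding magic_function_def using 2
      by (intro exI[of _ "\<lambda>i. if i = 0 then 1 else real a - 2"]) (auto simp: algebra_simps)
    moreover have "ehr_function n a b = (\<lambda>t. (real a - 1) * t + 1)"
      using 2 ab ehr_function_1[of b] by auto
    ultimately show ?thesis using 2 by simp
  next
    case 3
    define c where "c = real a - 1"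
    have c: "c \<ge> 0" using ab by (simp add: c_def)
    have b: "real b \<ge> 1" using ab by simp
    \<comment> \<open>In the basis (t + 1)^2, t (t + 1), t^2 a polynomial 1 + p t + q t^2 has
      coefficients 1, p - 2, q - p + 1. For a = 1 the last two are 3 b / 2 - 2 and (b - 1) (b - 2) /
      2, so b = 1 fails through the former.\<close>
    have "3 * real b / 2 + 2 * c - 2 \<ge> 0 \<and> c ^ 2 + 2 * c * real b + real b ^ 2 / 2 - 3 * real b / 2 - 2 * c + 1 \<ge> 0"
    proof (cases "a = 1")
      case True
      then have "real b \<ge> 2" using n 3 ab by auto
      then have "(real b - 1) * (real b - 2) \<ge> 0" by simp
      then show ?thesis using True \<open>real b \<ge> 2\<close> by (simp add: c_def power2_eq_square field_simps)
    next
      case False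
      then have c1: "c \<ge> 1" using ab by (simp add: c_def)
      then have "1 * real b \<le> c * real b" by (intro mult_right_mono) auto
      moreover have "0 \<le> c ^ 2 - 2 * c + 1"
        using zero_le_power2[of "c - 1"] by (simp add: power2_diff)
      moreover have "0 \<le> real b ^ 2" by simp
      ultimately show ?thesis using c1 b unfolding mult.assoc mult_1_left by linarith
    qed
    moreover have "(\<Sum>i\<le>2. g i) = g 0 + g 1 + g 2" for g :: "nat \<Rightarrow> real"
      by (simp add: numeral_2_eq_2)
    ultimately have "magic_function 2 (ehr_function 2 a b)"
      unfolding magic_function_def using ab
      by (intro exI[of _ "\<lambda>i. if i = 0 then 1 else if i = 1 then 3 * real b / 2 + 2 * c - 2 else
            c ^ 2 + 2 * c * real b + real b ^ 2 / 2 - 3 * real b / 2 - 2 * c + 1"])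
         (auto simp: ehr_function_2[OF ab(2)] c_def power2_eq_square algebra_simps)
    then show ?thesis using 3 by simp
  next
    case 4
    have "magic_function n (ehr_function n a b)"
      unfolding ehr_function_def
      using ab 4 by (intro magic_function_sum magic_function_cmult magic_function_linear magic_coeff_nonneg) auto
    then show ?thesis using 4 by simp
  qed
qed

section \<open>Lattice points of the polytope\<close>

unbundle no fps_syntax
unbundle vec_syntax

text \<open>Replaces the condition on the rearrangement by a count of small entries.\<close>

lemma nth_le_iff_length_filter:
  fixes xs :: "nat list"
  assumes "sorted xs" "k \<in> {1..length xs}"
  shows "xs ! (k - 1) \<le> s \<longleftrightarrow> k \<le> length (filter (\<lambda>x. x \<le> s) xs)"
proof -
  have len: "length (filter (\<lambda>x. x \<le> s) xs) = card {i. i < length xs \<and> xs ! i \<le> s}"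
    by (rule length_filter_conv_card)
  show ?thesis
  proof
    assume "xs ! (k - 1) \<le> s"
    moreover have "xs ! i \<le> xs ! (k - 1)" if "i < k" for i
      using that assms by (intro sorted_nth_mono) auto
    ultimately have "xs ! i \<le> s" if "i < k" for i
      using that order_trans by blast
    then have "{..<k} \<subseteq> {i. i < length xs \<and> xs ! i \<le> s}"
      using assms by auto
    then have "card {..<k} \<le> card {i. i < length xs \<and> xs ! i \<le> s}"
      by (intro card_mono) auto
    then show "k \<le> length (filter (\<lambda>x. x \<le> s) xs)" by (simp add: len)
  next
    assume k: "k \<le> length (filter (\<lambda>x. x \<le> s) xs)"
    show "xs ! (k - 1) \<le> s"
    proof (rule ccontr)
      assume "\<not> xs ! (k - 1) \<le> s"
      moreover have "xs ! (k - 1) \<le> xs ! i" if "k - 1 \<le> i" "i < length xs" for i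
        using that assms(1) by (intro sorted_nth_mono)
      ultimately have "\<not> xs ! i \<le> s" if "k - 1 \<le> i" "i < length xs" for i
        using that order_trans by blast
      then have "{i. i < length xs \<and> xs ! i \<le> s} \<subseteq> {..<k - 1}"
        by (auto simp: not_le[symmetric])
      then have "card {i. i < length xs \<and> xs ! i \<le> s} \<le> card {..<k - 1}"
        by (intro card_mono) auto
      then show False using k len assms(2) by auto
    qed
  qed
qed

lemma b_parking_function_iff:
  fixes \<beta> :: "nat ^ 'n"
  assumes "length bs = CARD('n)"
  shows "b_parking_function bs \<beta> \<longleftrightarrow> (\<forall>i. \<beta> $ i > 0) \<and>
     (\<forall>k\<in>{1..CARD('n)}. k \<le> card {i. \<beta> $ i \<le> sum_list (take k bs)})"
proof -
  have mset: "mset (rearrangement \<beta>) = image_mset (\<lambda>i. \<beta> $ i) (mset_set UNIV)"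
    by (simp add: rearrangement_def)
  have "length (rearrangement \<beta>) = CARD('n)"
    using arg_cong[OF mset, of size] by simp
  moreover have "sorted (rearrangement \<beta>)"
    by (simp add: rearrangement_def)
  moreover have "length (filter (\<lambda>x. x \<le> s) (rearrangement \<beta>)) = card {i. \<beta> $ i \<le> s}" for s
  proof -
    have "length (filter (\<lambda>x. x \<le> s) (rearrangement \<beta>)) = size (filter_mset (\<lambda>x. x \<le> s) (mset (rearrangement \<beta>)))"
      by (simp flip: mset_filter)
    also have "\<dots> = card {i. \<beta> $ i \<le> s}"
      by (simp add: mset filter_mset_image_mset)
    finally show ?thesis .
  qed
  ultimately show ?thesis
    using assms unfolding b_parking_function_def
    by (simp add: nth_le_iff_length_filter del: One_nat_def)
qed

lemma sum_list_take_ab: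
  assumes "k \<in> {1..n}"
  shows "sum_list (take k (a # replicate (n - 1) b)) = a + (k - 1) * b"
  using assms by (cases k) (auto simp: min_def sum_list_replicate)

lemma b_parking_function_ab_iff:
  fixes \<beta> :: "nat ^ 'n"
  shows "b_parking_function (a # replicate (CARD('n) - 1) b) \<beta> \<longleftrightarrow> (\<forall>i. \<beta> $ i > 0) \<and>
     (\<forall>k\<in>{1..CARD('n)}. k \<le> card {i. \<beta> $ i \<le> a + (k - 1) * b})"
  by (subst b_parking_function_iff) (simp_all add: sum_list_take_ab del: One_nat_def)

text \<open>The largest entries of a parking function are at most a + (n - 1) b, a + (n - 2) b and
  so on; this is the sum of the first r of these bounds.\<close>

definition facet_bound :: "nat \<Rightarrow> nat \<Rightarrow> nat \<Rightarrow> nat \<Rightarrow> real" where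
  "facet_bound n a b r = real r * (real a + (real n - 1) * real b) - real b * of_int (tri r)"

lemma facet_bound_0 [simp]: "facet_bound n a b 0 = 0"
  by (simp add: facet_bound_def)

lemma facet_bound_Suc:
  "facet_bound n a b (Suc r) = facet_bound n a b r + (real a + (real n - 1 - real r) * real b)"
  by (simp add: facet_bound_def tri_Suc algebra_simps)

definition parking_region :: "nat \<Rightarrow> nat \<Rightarrow> (real ^ 'n) set" where
  "parking_region a b =
     {x. (\<forall>i. 1 \<le> x $ i) \<and> (\<forall>R. (\<Sum>i\<in>R. x $ i) \<le> facet_bound CARD('n) a b (card R))}"

lemma real_vec_in_parking_region:
  fixes \<beta> :: "nat ^ 'n"
  assumes "b_parking_function (a # replicate (CARD('n) - 1) b) \<beta>"
  shows "real_vec \<beta> \<in> parking_region a b"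
proof -
  define n where "n = CARD('n)"
  have pos: "\<beta> $ i > 0" for i using assms by (simp add: b_parking_function_ab_iff del: One_nat_def)
  have low: "k \<le> card {i. \<beta> $ i \<le> a + (k - 1) * b}" if "k \<in> {1..n}" for k
    using assms that by (simp add: b_parking_function_ab_iff n_def del: One_nat_def)
  have "(\<Sum>i\<in>R. real (\<beta> $ i)) \<le> facet_bound n a b (card R)" if "card R = r" for R r
    using that
  proof (induction r arbitrary: R)
    case 0 then show ?case by simp
  next
    case (Suc r)
    have Rn: "card R \<le> n" unfolding n_def by (rule card_mono) auto
    define k where "k = n - r"
    have k: "k \<in> {1..n}" using Rn Suc.prems by (auto simp: k_def)
    \<comment> \<open>At least k = n - r entries are at most a + (k - 1) b, and r + 1 indices are
      too many to avoid them all.\<close>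
    have "\<exists>i\<in>R. \<beta> $ i \<le> a + (k - 1) * b"
    proof (rule ccontr)
      assume "\<not> (\<exists>i\<in>R. \<beta> $ i \<le> a + (k - 1) * b)"
      then have "R \<inter> {i. \<beta> $ i \<le> a + (k - 1) * b} = {}" by auto
      then have "card R + card {i. \<beta> $ i \<le> a + (k - 1) * b} = card (R \<union> {i. \<beta> $ i \<le> a + (k - 1) * b})"
        by (simp add: card_Un_disjoint)
      also have "\<dots> \<le> n" unfolding n_def by (rule card_mono) auto
      finally show False using low[OF k] Suc.prems Rn by (simp add: k_def)
    qed
    then obtain i where i: "i \<in> R" "\<beta> $ i \<le> a + (k - 1) * b" by blast
    have "card (R - {i}) = r" using i Suc.prems by simp
    then have IH: "(\<Sum>j\<in>R - {i}. real (\<beta> $ j)) \<le> facet_bound n a b r"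
      using Suc.IH[of "R - {i}"] by simp
    have "real (\<beta> $ i) \<le> real (a + (k - 1) * b)" using i(2) by (rule of_nat_mono)
    also have "\<dots> = real a + (real n - 1 - real r) * real b"
      using k Rn Suc.prems by (simp add: k_def of_nat_diff)
    finally have "real (\<beta> $ i) \<le> real a + (real n - 1 - real r) * real b" .
    moreover have "(\<Sum>j\<in>R. real (\<beta> $ j)) = real (\<beta> $ i) + (\<Sum>j\<in>R - {i}. real (\<beta> $ j))"
      using i by (intro sum.remove) auto
    ultimately show ?case using IH Suc.prems by (simp add: facet_bound_Suc)
  qed
  moreover have "1 \<le> real (\<beta> $ i)" for i using pos[of i] by simp
  ultimately show ?thesis by (simp add: parking_region_def real_vec_def n_def)
qed

lemma convex_parking_region: "convex (parking_region a b)"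
proof (rule convexI)
  fix x y :: "real ^ 'n" and u v :: real
  assume x: "x \<in> parking_region a b" and y: "y \<in> parking_region a b" and uv: "0 \<le> u" "0 \<le> v" "u + v = 1"
  have convex_le: "u * p + v * q \<le> c" if "p \<le> c" "q \<le> c" for p q c
    using uv that by (intro convex_bound_le) auto
  have "1 \<le> u * x $ i + v * y $ i" for i
    using convex_le[of "- x $ i" "-1" "- y $ i"] x y by (simp add: parking_region_def)
  moreover have "(\<Sum>i\<in>R. u * x $ i + v * y $ i) \<le> facet_bound CARD('n) a b (card R)" for R
    using convex_le[of "\<Sum>i\<in>R. x $ i" "facet_bound CARD('n) a b (card R)" "\<Sum>i\<in>R. y $ i"] x y
    by (simp add: parking_region_def sum.distrib sum_distrib_left)
  ultimately show "u *\<^sub>R x + v *\<^sub>R y \<in> parking_region a b"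
    by (simp add: parking_region_def)
qed

text \<open>Abel summation in inductive form: the weighted sum is at least its last weight times the
  partial sum of \<open>g\<close>.\<close>

lemma sum_antimono_mult_nonneg:
  fixes e g :: "nat \<Rightarrow> real"
  assumes e: "\<And>k. Suc k < n \<Longrightarrow> e (Suc k) \<le> e k" "\<And>k. k < n \<Longrightarrow> 0 \<le> e k"
    and g: "\<And>m. m \<le> n \<Longrightarrow> 0 \<le> (\<Sum>k<m. g k)"
  shows "0 \<le> (\<Sum>k<n. e k * g k)"
proof -
  have *: "e m * (\<Sum>k<Suc m. g k) \<le> (\<Sum>k<Suc m. e k * g k)" if "m < n" for m
    using that
  proof (induction m)
    case 0 then show ?case by simp
  next
    case (Suc m)
    have "e (Suc m) * (\<Sum>k<Suc m. g k) \<le> e m * (\<Sum>k<Suc m. g k)"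
      using e(1)[of m] g[of "Suc m"] Suc.prems by (intro mult_right_mono) auto
    also have "\<dots> \<le> (\<Sum>k<Suc m. e k * g k)" using Suc by simp
    finally show ?case by (simp add: distrib_left)
  qed
  show ?thesis
  proof (cases n)
    case 0 then show ?thesis by simp
  next
    case (Suc m)
    have "0 \<le> e m * (\<Sum>k<Suc m. g k)" using e(2)[of m] g[of "Suc m"] Suc by simp
    also have "\<dots> \<le> (\<Sum>k<Suc m. e k * g k)" using * Suc by simp
    finally show ?thesis using Suc by simp
  qed
qed

lemma ex_bij_betw_mono:
  fixes c :: "'n::finite \<Rightarrow> real"
  obtains \<sigma> :: "nat \<Rightarrow> 'n" where "bij_betw \<sigma> {..<CARD('n)} UNIV"
    "\<And>i j. i \<le> j \<Longrightarrow> j < CARD('n) \<Longrightarrow> c (\<sigma> i) \<le> c (\<sigma> j)"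
proof -
  obtain xs0 :: "'n list" where xs0: "set xs0 = UNIV" "distinct xs0"
    using finite_distinct_list[of "UNIV :: 'n set"] by auto
  define xs where "xs = sort_key c xs0"
  have xs: "set xs = UNIV" "distinct xs" "sorted (map c xs)"
    using xs0 by (simp_all add: xs_def)
  then have len: "length xs = CARD('n)" using distinct_card[of xs] by simp
  have "bij_betw ((!) xs) {..<CARD('n)} UNIV"
    using bij_betw_nth[OF xs(2)] xs(1) len by simp
  moreover have "c (xs ! i) \<le> c (xs ! j)" if "i \<le> j" "j < CARD('n)" for i j
    using sorted_nth_mono[OF xs(3), of i j] that len by simp
  ultimately show thesis by (rule that)
qed

text \<open>
  Edmonds' greedy algorithm: the most negative coefficients of the functional get the largest values,
  the nonnegative ones get \<open>1\<close>; optimality is Abel summation.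
\<close>

lemma greedy_parking_function:
  fixes c z :: "real ^ 'n"
  assumes a: "a > 0" and z: "z \<in> parking_region a b"
  obtains \<beta> :: "nat ^ 'n" where "b_parking_function (a # replicate (CARD('n) - 1) b) \<beta>"
    "c \<bullet> real_vec \<beta> \<le> c \<bullet> z"
proof -
  define n where "n = CARD('n)"
  obtain \<sigma> where \<sigma>: "bij_betw \<sigma> {..<n} (UNIV :: 'n set)"
    and mono: "\<And>i j. i \<le> j \<Longrightarrow> j < n \<Longrightarrow> c $ \<sigma> i \<le> c $ \<sigma> j"
    using ex_bij_betw_mono[of "\<lambda>i. c $ i"] unfolding n_def by metis
  define pos where "pos = inv_into {..<n} \<sigma>"
  have pos: "bij_betw pos UNIV {..<n}" unfolding pos_def using \<sigma> by (rule bij_betw_inv_into)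
  have pos_\<sigma>: "pos (\<sigma> k) = k" if "k < n" for k
    unfolding pos_def using \<sigma> that by (simp add: bij_betw_inv_into_left)
  have \<sigma>_pos: "\<sigma> (pos i) = i" for i
    unfolding pos_def using \<sigma> by (simp add: bij_betw_inv_into_right)
  have pos_less: "pos i < n" for i using pos by (auto simp: bij_betw_def)
  define \<beta> :: "nat ^ 'n" where "\<beta> = (\<chi> i. if c $ i < 0 then a + (n - 1 - pos i) * b else 1)"
  have "b_parking_function (a # replicate (CARD('n) - 1) b) \<beta>"
    unfolding b_parking_function_ab_iff unfolding n_def[symmetric]
  proof (intro conjI allI ballI)
    show "\<beta> $ i > 0" for i using a by (simp add: \<beta>_def)
    fix k assume k: "k \<in> {1..n}"
    have "k = card {n - k..<n}" using k by simp
    also have "\<dots> = card (\<sigma> ` {n - k..<n})"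
      using \<sigma> by (intro card_image[symmetric]) (auto simp: bij_betw_def intro: inj_on_subset)
    also have "\<dots> \<le> card {i. \<beta> $ i \<le> a + (k - 1) * b}"
    proof (intro card_mono subsetI)
      fix i assume "i \<in> \<sigma> ` {n - k..<n}"
      then obtain j where "i = \<sigma> j" "n - k \<le> j" "j < n" by auto
      then have "n - 1 - pos i \<le> k - 1" by (simp add: pos_\<sigma>)
      then have "(n - 1 - pos i) * b \<le> (k - 1) * b" by (rule mult_right_mono) simp
      then show "i \<in> {i. \<beta> $ i \<le> a + (k - 1) * b}" using a by (simp add: \<beta>_def)
    qed simp
    finally show "k \<le> card {i. \<beta> $ i \<le> a + (k - 1) * b}" .
  qed
  moreover have "c \<bullet> real_vec \<beta> \<le> c \<bullet> z"
  proof -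
    \<comment> \<open>The partial sums of the greedy values \<open>w\<close> are the facet bounds.
      Nonnegative coefficients get weight 0 here and are compared with the entry 1
      afterwards.\<close>
    define d where "d i = min (c $ i) 0" for i
    define w where "w k = real a + (real n - 1 - real k) * real b" for k
    have "0 \<le> (\<Sum>k<n. - d (\<sigma> k) * (w k - z $ \<sigma> k))"
    proof (rule sum_antimono_mult_nonneg)
      show "- d (\<sigma> (Suc k)) \<le> - d (\<sigma> k)" if "Suc k < n" for k
        using mono[of k "Suc k"] that by (simp add: d_def min_def)
      show "0 \<le> - d (\<sigma> k)" for k by (simp add: d_def)
      fix m assume m: "m \<le> n"
      have inj: "inj_on \<sigma> {..<m}" using \<sigma> m by (auto simp: bij_betw_def intro: inj_on_subset)
      have "(\<Sum>k<m. z $ \<sigma> k) = (\<Sum>i\<in>\<sigma> ` {..<m}. z $ i)" using inj by (simp add: sum.reindex)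
      also have "\<dots> \<le> facet_bound n a b (card (\<sigma> ` {..<m}))"
        using z by (simp add: parking_region_def n_def)
      also have "card (\<sigma> ` {..<m}) = m" using inj by (simp add: card_image)
      also have "facet_bound n a b m = (\<Sum>k<m. w k)"
        by (induction m) (simp_all add: facet_bound_Suc w_def)
      finally show "0 \<le> (\<Sum>k<m. w k - z $ \<sigma> k)" by (simp add: sum_subtractf)
    qed
    also have "\<dots> = (\<Sum>i\<in>UNIV. - d i * (w (pos i) - z $ i))"
      using sum.reindex_bij_betw[OF pos, of "\<lambda>k. - d (\<sigma> k) * (w k - z $ \<sigma> k)"]
      by (simp add: \<sigma>_pos)
    also have "\<dots> \<le> (\<Sum>i\<in>UNIV. c $ i * (z $ i - real (\<beta> $ i)))"
    proof (rule sum_mono)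
      fix i
      have z1: "1 \<le> z $ i" using z by (simp add: parking_region_def)
      show "- d i * (w (pos i) - z $ i) \<le> c $ i * (z $ i - real (\<beta> $ i))"
      proof (cases "c $ i < 0")
        case True
        then have "real (\<beta> $ i) = w (pos i)"
          using pos_less[of i] by (simp add: \<beta>_def w_def of_nat_diff)
        then show ?thesis using True by (simp add: d_def algebra_simps)
      next
        case False
        then show ?thesis using z1 by (simp add: d_def \<beta>_def)
      qed
    qed
    also have "\<dots> = c \<bullet> z - c \<bullet> real_vec \<beta>"
      by (simp add: inner_vec_def real_vec_def right_diff_distrib sum_subtractf)
    finally show ?thesis by simp
  qed
  ultimately show thesis by (rule that)
qed

lemma finite_b_parking_functions:
  "finite {\<beta> :: nat ^ 'n. b_parking_function (a # replicate (CARD('n) - 1) b) \<beta>}"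
proof (rule finite_subset)
  define M where "M = a + (CARD('n) - 1) * b"
  show "{\<beta> :: nat ^ 'n. b_parking_function (a # replicate (CARD('n) - 1) b) \<beta>}
      \<subseteq> vec_lambda ` (UNIV \<rightarrow>\<^sub>E {0..M})"
  proof
    fix \<beta> :: "nat ^ 'n" assume "\<beta> \<in> {\<beta>. b_parking_function (a # replicate (CARD('n) - 1) b) \<beta>}"
    then have "\<forall>k\<in>{1..CARD('n)}. k \<le> card {i. \<beta> $ i \<le> a + (k - 1) * b}"
      by (simp add: b_parking_function_ab_iff del: One_nat_def)
    from bspec[OF this, of "CARD('n)"] have "CARD('n) \<le> card {i. \<beta> $ i \<le> M}"
      by (simp add: M_def)
    then have "{i. \<beta> $ i \<le> M} = UNIV" by (intro card_seteq) auto
    then have "vec_nth \<beta> \<in> UNIV \<rightarrow>\<^sub>E {0..M}" by auto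
    then show "\<beta> \<in> vec_lambda ` (UNIV \<rightarrow>\<^sub>E {0..M})"
      by (metis image_eqI vec_nth_inverse)
  qed
  show "finite (vec_lambda ` (UNIV \<rightarrow>\<^sub>E {0..M}) :: (nat ^ 'n) set)"
    by (intro finite_imageI finite_PiE) auto
qed

text \<open>A point of the region outside the polytope could be strictly separated from it by a
  linear functional, but for every functional some greedy parking function is at least as small as
  that point.\<close>

lemma parking_polytope_ab_eq_region:
  assumes "a > 0"
  shows "(parking_polytope_ab a b :: (real ^ 'n) set) = parking_region a b"
proof
  show "(parking_polytope_ab a b :: (real ^ 'n) set) \<subseteq> parking_region a b"
    unfolding parking_polytope_ab_def parking_polytope_def
    by (intro hull_minimal convex_parking_region) (auto intro: real_vec_in_parking_region)
  show "(parking_region a b :: (real ^ 'n) set) \<subseteq> parking_polytope_ab a b"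
  proof (rule ccontr)
    let ?P = "parking_polytope_ab a b :: (real ^ 'n) set"
    assume "\<not> parking_region a b \<subseteq> ?P"
    then obtain z where z: "z \<in> parking_region a b" "z \<notin> ?P" by blast
    have "convex ?P" "closed ?P"
      unfolding parking_polytope_ab_def parking_polytope_def
      using finite_b_parking_functions[of a b]
      by (auto intro!: compact_imp_closed finite_imp_compact_convex_hull)
    then obtain c r where c: "c \<bullet> z < r" "\<And>x. x \<in> ?P \<Longrightarrow> r < c \<bullet> x"
      using separating_hyperplane_closed_point[of ?P z] z(2) by blast
    obtain \<beta> :: "nat ^ 'n" where \<beta>: "b_parking_function (a # replicate (CARD('n) - 1) b) \<beta>"
      "c \<bullet> real_vec \<beta> \<le> c \<bullet> z"
      using greedy_parking_function[OF assms z(1)] .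
    have "real_vec \<beta> \<in> ?P"
      unfolding parking_polytope_ab_def parking_polytope_def
      using \<beta>(1) by (intro hull_inc) auto
    then show False using c \<beta>(2) by force
  qed
qed

lemma lattice_polytope_parking_polytope_ab:
  assumes "a > 0"
  shows "lattice_polytope (parking_polytope_ab a b :: (real ^ 'n) set)"
proof -
  define V :: "(real ^ 'n) set"
    where "V = real_vec ` {\<beta>. b_parking_function (a # replicate (CARD('n) - 1) b) \<beta>}"
  have "finite V" unfolding V_def by (intro finite_imageI finite_b_parking_functions)
  moreover have "b_parking_function (a # replicate (CARD('n) - 1) b) (\<chi> i :: 'n. 1)"
    using assms by (simp add: b_parking_function_ab_iff del: One_nat_def)
  then have "V \<noteq> {}" by (auto simp: V_def)
  moreover have "V \<subseteq> integer_points" by (auto simp: V_def integer_points_def real_vec_def)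
  ultimately show ?thesis
    unfolding lattice_polytope_def parking_polytope_ab_def parking_polytope_def V_def[symmetric] by blast
qed

section \<open>Lattice points of the dilates\<close>

lemma scaled_parking_region:
  fixes x :: "real ^ 'n"
  assumes "t > 0"
  shows "x \<in> (\<lambda>x. t *\<^sub>R x) ` parking_region a b \<longleftrightarrow> (\<forall>i. t \<le> x $ i) \<and>
     (\<forall>R. (\<Sum>i\<in>R. x $ i) \<le> t * facet_bound CARD('n) a b (card R))"
proof -
  have "x \<in> (\<lambda>x. t *\<^sub>R x) ` parking_region a b \<longleftrightarrow> (1 / t) *\<^sub>R x \<in> parking_region a b"
  proof
    assume "x \<in> (\<lambda>x. t *\<^sub>R x) ` parking_region a b"
    then show "(1 / t) *\<^sub>R x \<in> parking_region a b" using assms by auto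
  next
    assume *: "(1 / t) *\<^sub>R x \<in> parking_region a b"
    have "x = t *\<^sub>R ((1 / t) *\<^sub>R x)" using assms by simp
    then show "x \<in> (\<lambda>x. t *\<^sub>R x) ` parking_region a b" using * by (rule image_eqI)
  qed
  also have "\<dots> \<longleftrightarrow> (\<forall>i. t \<le> x $ i) \<and>
     (\<forall>R. (\<Sum>i\<in>R. x $ i) \<le> t * facet_bound CARD('n) a b (card R))"
    using assms by (simp add: parking_region_def field_simps flip: sum_divide_distrib)
  finally show ?thesis .
qed

lemma card_scaled_parking_region:
  assumes ab: "a > 0" "b > 0" and t: "t > 0"
  shows "card ((\<lambda>x :: real ^ 'n. real t *\<^sub>R x) ` parking_region a b \<inter> integer_points) =
    landau_count (int t * int b) 0 (int t * (int a - 1)) CARD('n)"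
proof -
  define n where "n = CARD('n)"
  \<comment> \<open>M is the largest entry in the dilate. Reflection at M turns the lower bound t
    into the upper bound m = B (n - 1) + A.\<close>
  define M where "M = int t * (int a + (int n - 1) * int b)"
  define m where "m = M - int t"
  let ?L = "landau (int t * int b) 0 0 m (UNIV :: 'n set)"
  define \<Phi> :: "('n \<Rightarrow> int) \<Rightarrow> real ^ 'n" where "\<Phi> y = (\<chi> i. of_int (M - y i))" for y
  have mem: "\<Phi> y \<in> (\<lambda>x. real t *\<^sub>R x) ` parking_region a b \<longleftrightarrow> y \<in> ?L" for y
  proof -
    have "real t \<le> of_int (M - y i) \<longleftrightarrow> y i \<le> m" for i
    proof -
      have "real t \<le> of_int (M - y i) \<longleftrightarrow> (of_int (int t) :: real) \<le> of_int (M - y i)" by simp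
      also have "\<dots> \<longleftrightarrow> int t \<le> M - y i" by (rule of_int_le_iff)
      finally show ?thesis by (auto simp: m_def)
    qed
    moreover have "(\<Sum>i\<in>R. of_int (M - y i)) \<le> real t * facet_bound n a b (card R) \<longleftrightarrow>
        int t * int b * tri (card R) \<le> sum y R" for R
    proof -
      have "(\<Sum>i\<in>R. of_int (M - y i)) = (of_int (int (card R) * M - sum y R) :: real)"
        by (simp add: sum_subtractf)
      moreover have "real t * facet_bound n a b (card R) =
          of_int (int (card R) * M - int t * int b * tri (card R))"
        by (simp add: facet_bound_def M_def algebra_simps)
      ultimately show ?thesis by (simp only: of_int_le_iff) auto
    qed
    moreover have "(\<forall>R. R \<noteq> {} \<longrightarrow> int t * int b * tri (card R) \<le> sum y R) \<longleftrightarrow>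
        (\<forall>R. int t * int b * tri (card R) \<le> sum y R)"
      by (metis card.empty mult_zero_right order_refl sum.empty tri_0)
    ultimately show ?thesis
      using t by (simp add: scaled_parking_region \<Phi>_def landau_def n_def del: of_int_diff)
  qed
  have "bij_betw \<Phi> ?L ((\<lambda>x. real t *\<^sub>R x) ` parking_region a b \<inter> integer_points)"
    unfolding bij_betw_def
  proof
    show "inj_on \<Phi> ?L" by (auto simp: inj_on_def \<Phi>_def vec_eq_iff)
    show "\<Phi> ` ?L = (\<lambda>x. real t *\<^sub>R x) ` parking_region a b \<inter> integer_points"
    proof (intro equalityI subsetI)
      fix x assume "x \<in> \<Phi> ` ?L"
      then obtain y where y: "y \<in> ?L" "x = \<Phi> y" by blast
      then have "x \<in> (\<lambda>x. real t *\<^sub>R x) ` parking_region a b" using mem by simp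
      moreover have "x \<in> integer_points" by (simp add: y integer_points_def \<Phi>_def)
      ultimately show "x \<in> (\<lambda>x. real t *\<^sub>R x) ` parking_region a b \<inter> integer_points" by blast
    next
      fix x :: "real ^ 'n" assume x: "x \<in> (\<lambda>x. real t *\<^sub>R x) ` parking_region a b \<inter> integer_points"
      have "x = \<Phi> (\<lambda>i. M - \<lfloor>x $ i\<rfloor>)"
        using x by (auto simp: \<Phi>_def integer_points_def vec_eq_iff)
      then show "x \<in> \<Phi> ` ?L" using x mem[of "\<lambda>i. M - \<lfloor>x $ i\<rfloor>"] by (metis IntD1 image_eqI)
    qed
  qed
  then have "card ((\<lambda>x. real t *\<^sub>R x) ` parking_region a b \<inter> (integer_points :: (real ^ 'n) set)) = card ?L"
    by (rule bij_betw_same_card[symmetric])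
  also have "\<dots> = landau_count (int t * int b) 0 (int t * (int a - 1)) n"
    by (subst card_landau) (simp_all add: m_def M_def n_def algebra_simps)
  finally show ?thesis by (simp add: n_def)
qed

section \<open>Ehrhart polynomial, dimension and the exceptional case\<close>

lemma poly_ehr_parking_polytope_ab:
  assumes ab: "a > 0" "b > 0"
  shows "poly (ehr (parking_polytope_ab a b :: (real ^ 'n) set)) t = ehr_function CARD('n) a b t"
proof -
  define p :: "real poly" where "p = (\<Sum>j\<le>CARD('n).
    smult (magic_coeff ((real a - 1) / real b) CARD('n) j) ([:0, real b:] ^ (CARD('n) - j) * [:1, real b:] ^ j))"
  have p: "poly p t = ehr_function CARD('n) a b t" for t
    by (simp add: p_def ehr_function_def poly_sum add.commute mult.commute[of t])
  have "is_ehrhart_poly (parking_polytope_ab a b :: (real ^ 'n) set) p"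
    unfolding is_ehrhart_poly_def p parking_polytope_ab_eq_region[OF ab(1)]
    using ab by (simp add: card_scaled_parking_region landau_count_ehr_function)
  then show ?thesis by (simp add: ehr_eqI p)
qed

lemma aff_dim_parking_polytope_ab:
  assumes ab: "a > 0" "b > 0"
  shows "aff_dim (parking_polytope_ab a b :: (real ^ 'n) set) =
    (if CARD('n) = 1 \<and> a = 1 then 0 else int CARD('n))"
proof (cases "CARD('n) = 1 \<and> a = 1")
  case True
  have "(parking_region a b :: (real ^ 'n) set) = {\<chi> i. 1}"
  proof (intro equalityI subsetI)
    fix x :: "real ^ 'n" assume x: "x \<in> parking_region a b"
    have "x $ i = 1" for i
    proof -
      have "(\<Sum>i\<in>{i}. x $ i) \<le> facet_bound CARD('n) a b (card {i})"
        using x unfolding parking_region_def by blast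
      moreover have "1 \<le> x $ i" using x by (simp add: parking_region_def)
      ultimately show ?thesis using True by (simp add: facet_bound_def)
    qed
    then show "x \<in> {\<chi> i. 1}" by (simp add: vec_eq_iff)
  next
    fix x :: "real ^ 'n" assume x: "x \<in> {\<chi> i. 1}"
    have "real (card R) \<le> facet_bound CARD('n) a b (card R)" for R :: "'n set"
    proof -
      have "card R \<le> 1" using card_mono[of UNIV R] True by simp
      then have "card R = 0 \<or> card R = 1" by linarith
      then show ?thesis using True by (auto simp: facet_bound_def)
    qed
    then show "x \<in> parking_region a b" using x by (simp add: parking_region_def)
  qed
  then show ?thesis using True ab by (simp add: parking_polytope_ab_eq_region)
next
  case False
  define n where "n = CARD('n)"
  \<comment> \<open>A cube of side 2 \<delta> with lower corner (1, ..., 1) fits inside: the bound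
    for r entries minus r is r (a - 1 + (n - 1) b - (r - 1) b / 2), which for r \<le> n is at least
    2 \<delta> r, with equality at r = n.\<close>
  define \<delta> where "\<delta> = (real a - 1 + (real n - 1) * real b / 2) / 2"
  have n: "n \<ge> 1" by (simp add: n_def)
  have "\<delta> > 0"
  proof (cases "a = 1")
    case True
    then have "n > 1" using False n unfolding n_def by linarith
    then show ?thesis using True ab by (simp add: \<delta>_def)
  next
    case 2: False
    then have "real a - 1 > 0" "(real n - 1) * real b / 2 \<ge> 0" using ab n by simp_all
    then show ?thesis by (simp add: \<delta>_def)
  qed
  have "cbox (\<chi> i. 1) (\<chi> i. 1 + 2 * \<delta>) \<subseteq> (parking_region a b :: (real ^ 'n) set)"
  proof
    fix x :: "real ^ 'n" assume "x \<in> cbox (\<chi> i. 1) (\<chi> i. 1 + 2 * \<delta>)"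
    then have x: "1 \<le> x $ i" "x $ i \<le> 1 + 2 * \<delta>" for i by (simp_all add: mem_box_cart)
    have "(\<Sum>i\<in>R. x $ i) \<le> facet_bound n a b (card R)" for R
    proof -
      have "card R \<le> n" unfolding n_def by (rule card_mono) auto
      then have "real (card R) * (real (card R) - 1) * real b \<le> real (card R) * (real n - 1) * real b"
        by (intro mult_right_mono mult_left_mono) auto
      moreover have "2 * (real b * of_int (tri (card R))) = real (card R) * (real (card R) - 1) * real b"
        using arg_cong[OF two_tri[of "card R"], of "\<lambda>x. real b * of_int x"] by simp
      moreover have "(\<Sum>i\<in>R. x $ i) \<le> (\<Sum>i\<in>R. 1 + 2 * \<delta>)" by (intro sum_mono x)
      ultimately show ?thesis by (simp add: facet_bound_def \<delta>_def field_simps)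
    qed
    then show "x \<in> parking_region a b" using x by (simp add: parking_region_def n_def)
  qed
  then have "interior (cbox (\<chi> i. 1) (\<chi> i. 1 + 2 * \<delta>)) \<subseteq> interior (parking_region a b :: (real ^ 'n) set)"
    by (rule interior_mono)
  moreover have "(\<chi> i. 1 + \<delta>) \<in> interior (cbox (\<chi> i. 1) (\<chi> i. 1 + 2 * \<delta>) :: (real ^ 'n) set)"
    using \<open>\<delta> > 0\<close> by (simp add: interior_cbox mem_box_cart)
  ultimately have "interior (parking_region a b :: (real ^ 'n) set) \<noteq> {}" by blast
  then have "aff_dim (parking_region a b :: (real ^ 'n) set) = int (DIM(real ^ 'n))"
    by (rule aff_dim_nonempty_interior)
  then show ?thesis using False ab by (auto simp: parking_polytope_ab_eq_region)
qed

lemma PF_eq_parking_polytope_ab: "(PF :: (real ^ 2) set) = parking_polytope_ab 1 1"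
proof -
  have "sum_list (take i [1, 1]) = i" if "i \<in> {1..2}" for i :: nat
  proof -
    have "i = 1 \<or> i = 2" using that by auto
    then show ?thesis by auto
  qed
  then have "b_parking_function [1, 1] \<alpha> \<longleftrightarrow> classical_parking_function \<alpha>" for \<alpha> :: "nat ^ 2"
    by (simp add: b_parking_function_def classical_parking_function_def)
  then show ?thesis
    by (simp add: PF_def parking_polytope_ab_def parking_polytope_def numeral_2_eq_2)
qed

lemma magic_positive_parking_polytope_ab_iff:
  assumes ab: "a > 0" "b > 0"
  shows "magic_positive (parking_polytope_ab a b :: (real ^ 'n) set) \<longleftrightarrow>
    magic_function (if CARD('n) = 1 \<and> a = 1 then 0 else CARD('n)) (ehr_function CARD('n) a b)"
  using ab unfolding magic_positive_def magic_function_def Let_def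
  by (simp add: lattice_polytope_parking_polytope_ab aff_dim_parking_polytope_ab poly_ehr_parking_polytope_ab)

lemma not_magic_function_2_1_1: "\<not> magic_function 2 (ehr_function 2 1 1)"
proof
  assume "magic_function 2 (ehr_function 2 1 1)"
  then obtain \<mu> :: "nat \<Rightarrow> real" where \<mu>: "\<forall>i\<le>2. \<mu> i \<ge> 0"
    and eq: "\<And>t. ehr_function 2 1 1 t = (\<Sum>i\<le>2. \<mu> i * t ^ i * (t + 1) ^ (2 - i))"
    unfolding magic_function_def by blast
  have "(\<Sum>i\<le>2. g i) = g 0 + g 1 + g 2" for g :: "nat \<Rightarrow> real"
    by (simp add: numeral_2_eq_2)
  then have "1 + 3 / 2 * t + t ^ 2 / 2 = \<mu> 0 * (t + 1) ^ 2 + \<mu> 1 * t * (t + 1) + \<mu> 2 * t ^ 2" for t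
    using eq[of t] by (simp add: ehr_function_2)
  \<comment> \<open>The values at 0 and -1 give \<mu> 0 = 1 and \<mu> 2 = 0; the value 3 at 1 then
    gives \<mu> 1 = -1/2.\<close>
  from this[of 0] this[of 1] this[of "-1"] have "\<mu> 1 < 0" by simp
  moreover have "\<mu> 1 \<ge> 0" using \<mu> by simp
  ultimately show False by simp
qed

theorem theorem7p2:
  fixes a b :: nat
  assumes "a > 0" and "b > 0"
  shows "(magic_positive (parking_polytope_ab a b :: (real ^ 'n) set)
            \<longleftrightarrow> (CARD('n), a, b) \<noteq> (2, 1, 1))
         \<and> (parking_polytope_ab 1 1 :: (real ^ 2) set) = PF
         \<and> (\<forall>t::real. poly (ehr (PF :: (real ^ 2) set)) t = (t + 1) * (t + 2) / 2
                     \<and> (t + 1) * (t + 2) / 2 = (t + 1)^2 - 1/2 * (t * (t + 1)))"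
proof (intro conjI allI)
  show "magic_positive (parking_polytope_ab a b :: (real ^ 'n) set) \<longleftrightarrow> (CARD('n), a, b) \<noteq> (2, 1, 1)"
  proof (cases "(CARD('n), a, b) = (2, 1, 1)")
    case True
    then show ?thesis
      using magic_positive_parking_polytope_ab_iff[OF assms, where ?'n = 'n] not_magic_function_2_1_1 by simp
  next
    case False
    then show ?thesis
      using magic_positive_parking_polytope_ab_iff[OF assms, where ?'n = 'n]
        magic_function_ehr_function[OF assms, of "CARD('n)"] by simp
  qed
  show "(parking_polytope_ab 1 1 :: (real ^ 2) set) = PF"
    by (rule PF_eq_parking_polytope_ab[symmetric])
  fix t :: real
  show "poly (ehr (PF :: (real ^ 2) set)) t = (t + 1) * (t + 2) / 2"
  proof -
    have "poly (ehr (PF :: (real ^ 2) set)) t = ehr_function CARD(2) 1 1 t"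
      unfolding PF_eq_parking_polytope_ab by (rule poly_ehr_parking_polytope_ab) simp_all
    also have "CARD(2) = 2" by simp
    also have "ehr_function 2 1 1 t = (t + 1) * (t + 2) / 2"
      by (simp add: ehr_function_2 power2_eq_square field_simps)
    finally show ?thesis .
  qed
  show "(t + 1) * (t + 2) / 2 = (t + 1)^2 - 1/2 * (t * (t + 1))"
    by (simp add: power2_eq_square field_simps)
qed

end
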